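(* Let assumption (A) of the context hold. Consider the variance-reduced accelerated SGD algorithm $$y_{k+1}=x_k-\alpha(\nabla f(x_k)+w_{k,N_k}),\qquad x_{k+1}=y_{k+1}+\beta(y_{k+1}-y_k),\qquad k\ge0,$$ where $\alpha\in(0,\tfrac1L]$, $\gamma=\sqrt{\alpha\eta}$, $\beta=\tfrac{1-\gamma}{1+\gamma}$, and $N_k=\lceil\rho_2^{-(k+1)}\rceil$ with $\rho_2\in(1-\gamma,1)$. Then for any $k\ge0$, $$\mathbb E[f(y_k)]-f^*\le\rho_2^k\Big(\tfrac{\eta+L}2\,\mathbb E[\|x_0-x^*\|^2]+\tfrac{\rho_2\nu^2}{\rho_2-(1-\gamma)}\big(\alpha+\tfrac{(1-\gamma)\gamma}{2\eta}\big)\Big),$$ and $\mathbb E[\|x_k-x^*\|^2]\le c\rho_2^k$ for some constant $c>0$. In addition, the iteration and oracle complexity for obtaining an $\epsilon$-solution are $\mathcal O(\sqrt\kappa\ln(1/\epsilon))$ and $\mathcal O(\sqrt\kappa/\epsilon)$, respectively, where $\kappa=L/\eta$.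
   Context: Problem: minimize $f(x)=\mathbb E[F(x,\boldsymbol\xi)]$ over $x\in\mathbb R^m$, where $\boldsymbol\xi$ is an $\mathbb R^d$-valued random vector and $F:\mathbb R^m\times\mathbb R^d\to\mathbb R$. Sampled gradients $\nabla F(x,\xi)$ (gradient in $x$) are available. The algorithm starts from $x_0=y_0\in\mathbb R^m$ with positive constants $\alpha,\beta$ and positive integers $N_k$ (batch sizes); $\xi_{j,k}$ ($1\le j\le N_k$, $k\ge 0$) are i.i.d. copies of $\boldsymbol\xi$; $w_{k,N_k}=\frac1{N_k}\sum_{j=1}^{N_k}\nabla F(x_k,\xi_{j,k})-\nabla f(x_k)$; and $\mathcal F_k=\sigma\{x_0,\xi_{j,t}:1\le j\le N_t,\,0\le t\le k-1\}$, so $x_k$ is $\mathcal F_k$-measurable. Assumption (A): (i) $f$ is continuously differentiable on $\mathbb R^m$ and $\|\nabla f(x)-\nabla f(x')\|\le L\|x-x'\|$ for all $x,x'$, with $L>0$; (ii) $f$ is $\eta$-strongly convex, $\eta>0$: $(\nabla f(x)-\nabla f(x'))^T(x-x')\ge\eta\|x-x'\|^2$ for all $x,x'$; (iii) there is $\nu>0$ such that for all $k\ge0$ and $1\le j\le N_k$, almost surely $\mathbb E[\nabla F(x_k,\xi_{j,k})\mid\mathcal F_k]=\nabla f(x_k)$ and $\mathbb E[\|\nabla F(x_k,\xi_{j,k})-\nabla f(x_k)\|^2\mid\mathcal F_k]\le\nu^2$. The unique minimizer of $f$ is denoted $x^*$ and $f^*=f(x^* )$. Iteration complexity is the number of iterations,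 and oracle complexity the total number of sampled gradients, needed to obtain an $\epsilon$-solution, i.e. $\mathbb E[\|x_k-x^*\|^2]\le\epsilon$. *)

theory Defs
  imports "HOL-Probability.Probability"
begin

text \<open>
  Conventions: \<open>F x z\<close> is the sampled objective, \<open>gF x z\<close> its gradient in \<open>x\<close>, \<open>gf\<close> the
  gradient of \<open>f\<close>, \<open>xi j k\<close> the \<open>j\<close>-th sample (\<open>1 \<le> j \<le> N k\<close>) of step \<open>k\<close>. The iterates
  \<open>x k\<close>, \<open>y k\<close> are random vectors, and the initial point \<open>x 0\<close> may be random.
\<close>

definition batch_indices :: "(nat \<Rightarrow> nat) \<Rightarrow> (nat \<times> nat) set" where
  "batch_indices N = {(j, k). 1 \<le> j \<and> j \<le> N k}"

definition rv_sigma :: "'w measure \<Rightarrow> ('w \<Rightarrow> 'a::topological_space) \<Rightarrow> 'w set set" where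
  "rv_sigma M X = sets (vimage_algebra (space M) X borel)"

definition history ::
  "'w measure \<Rightarrow> (nat \<Rightarrow> nat) \<Rightarrow> ('w \<Rightarrow> real^'m) \<Rightarrow> (nat \<Rightarrow> nat \<Rightarrow> 'w \<Rightarrow> real^'d) \<Rightarrow> nat \<Rightarrow> 'w measure"
where
  "history M N x0 xi k =
     sigma (space M)
       (rv_sigma M x0 \<union> (\<Union>(j, t) \<in> {(j, t) \<in> batch_indices N. t < k}. rv_sigma M (xi j t)))"

definition vec_cond_exp ::
  "'w measure \<Rightarrow> 'w measure \<Rightarrow> ('w \<Rightarrow> real^'m) \<Rightarrow> 'w \<Rightarrow> real^'m" where
  "vec_cond_exp M G X w = (\<chi> i. real_cond_exp M G (\<lambda>w. X w $ i) w)"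

definition grad_noise ::
  "(real^'m \<Rightarrow> real^'d \<Rightarrow> real^'m) \<Rightarrow> (real^'m \<Rightarrow> real^'m) \<Rightarrow> (nat \<Rightarrow> nat) \<Rightarrow>
   (nat \<Rightarrow> nat \<Rightarrow> 'w \<Rightarrow> real^'d) \<Rightarrow> (nat \<Rightarrow> 'w \<Rightarrow> real^'m) \<Rightarrow> nat \<Rightarrow> 'w \<Rightarrow> real^'m"
where
  "grad_noise gF gf N xi x k w =
     (1 / real (N k)) *\<^sub>R (\<Sum>j=1..N k. gF (x k w) (xi j k w)) - gf (x k w)"

locale stochastic_problem = prob_space M
  for M :: "'w measure" +
  fixes F :: "real^'m \<Rightarrow> real^'d \<Rightarrow> real"
    and gF :: "real^'m \<Rightarrow> real^'d \<Rightarrow> real^'m"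
    and f :: "real^'m \<Rightarrow> real"
    and gf :: "real^'m \<Rightarrow> real^'m"
    and xi0 :: "'w \<Rightarrow> real^'d"
  assumes xi0_rv: "random_variable borel xi0"
    and F_measurable: "case_prod F \<in> borel_measurable (borel \<Otimes>\<^sub>M borel)"
    and F_gradient: "\<And>u z. GDERIV (\<lambda>u. F u z) u :> gF u z"
    and F_integrable: "\<And>u. integrable M (\<lambda>w. F u (xi0 w))"
    and f_eq: "\<And>u. f u = expectation (\<lambda>w. F u (xi0 w))"
    and f_gradient: "\<And>u. GDERIV f u :> gf u"

text \<open>
  The initial point and all samples are mutually independent (index \<open>None\<close> stands for the
  initial point). The conditional second moment is the extended-valued \<open>nn_cond_exp\<close>, so the
  variance bound is meaningful without a separate integrability assumption; integrability of the
  sampled gradients then follows from \<open>initial_L2\<close>.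
\<close>

locale accelerated_sgd = stochastic_problem M F gF f gf xi0
  for M :: "'w measure" and F :: "real^'m \<Rightarrow> real^'d \<Rightarrow> real" and gF f gf xi0 +
  fixes L \<eta> \<nu> \<alpha> \<beta> :: real
    and N :: "nat \<Rightarrow> nat"
    and xi :: "nat \<Rightarrow> nat \<Rightarrow> 'w \<Rightarrow> real^'d"
    and x y :: "nat \<Rightarrow> 'w \<Rightarrow> real^'m"
    and xstar :: "real^'m"
  assumes constants_pos: "L > 0" "\<eta> > 0" "\<nu> > 0"
    and gf_continuous: "continuous_on UNIV gf"
    and gf_lipschitz: "\<And>u v. norm (gf u - gf v) \<le> L * norm (u - v)"
    and strongly_convex: "\<And>u v. (gf u - gf v) \<bullet> (u - v) \<ge> \<eta> * (norm (u - v))\<^sup>2"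
    and minimizer: "\<And>u. f xstar \<le> f u"
    and batch_pos: "\<And>k. N k > 0"
    and initial_rv: "random_variable borel (x 0)"
    and initial_L2: "integrable M (\<lambda>w. (norm (x 0 w))\<^sup>2)"
    and sample_rv: "\<And>j k. (j, k) \<in> batch_indices N \<Longrightarrow> random_variable borel (xi j k)"
    and sample_distr: "\<And>j k. (j, k) \<in> batch_indices N \<Longrightarrow> distr M borel (xi j k) = distr M borel xi0"
    and independence:
      "indep_sets (case_option (rv_sigma M (x 0)) (\<lambda>(j, k). rv_sigma M (xi j k)))
         (insert None (Some ` batch_indices N))"
    and start: "\<And>w. w \<in> space M \<Longrightarrow> x 0 w = y 0 w"
    and y_step: "\<And>k w. w \<in> space M \<Longrightarrow>
      y (Suc k) w = x k w - \<alpha> *\<^sub>R (gf (x k w) + grad_noise gF gf N xi x k w)"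
    and x_step: "\<And>k w. w \<in> space M \<Longrightarrow>
      x (Suc k) w = y (Suc k) w + \<beta> *\<^sub>R (y (Suc k) w - y k w)"
    and unbiased: "\<And>j k. (j, k) \<in> batch_indices N \<Longrightarrow>
      AE w in M. vec_cond_exp M (history M N (x 0) xi k) (\<lambda>w. gF (x k w) (xi j k w)) w = gf (x k w)"
    and variance_bound: "\<And>j k. (j, k) \<in> batch_indices N \<Longrightarrow>
      AE w in M. nn_cond_exp M (history M N (x 0) xi k)
        (\<lambda>w. ennreal ((norm (gF (x k w) (xi j k w) - gf (x k w)))\<^sup>2)) w \<le> ennreal (\<nu>\<^sup>2)"

definition mean_sq_error :: "'w measure \<Rightarrow> (nat \<Rightarrow> 'w \<Rightarrow> real^'m) \<Rightarrow> real^'m \<Rightarrow> nat \<Rightarrow> real" where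
  "mean_sq_error M x xstar k = (\<integral>w. (norm (x k w - xstar))\<^sup>2 \<partial>M)"

definition iteration_complexity ::
  "'w measure \<Rightarrow> (nat \<Rightarrow> 'w \<Rightarrow> real^'m) \<Rightarrow> real^'m \<Rightarrow> real \<Rightarrow> nat" where
  "iteration_complexity M x xstar \<epsilon> = (LEAST k. mean_sq_error M x xstar k \<le> \<epsilon>)"

text \<open>Computing \<open>x K\<close> uses the batches of the steps \<open>0, \<dots>, K - 1\<close>.\<close>

definition oracle_complexity ::
  "'w measure \<Rightarrow> (nat \<Rightarrow> nat) \<Rightarrow> (nat \<Rightarrow> 'w \<Rightarrow> real^'m) \<Rightarrow> real^'m \<Rightarrow> real \<Rightarrow> nat" where
  "oracle_complexity M N x xstar \<epsilon> = (\<Sum>k < iteration_complexity M x xstar \<epsilon>. N k)"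

end

theory Submission
  imports Defs "HOL-Real_Asymp.Real_Asymp"
begin

text \<open>
  With \<open>v k = ((1 + \<gamma>) x k - y k) / \<gamma>\<close>, the function
  \<open>V k = f (y k) - f x\<^sup>* + \<eta> / 2 \<parallel>v k - x\<^sup>*\<parallel>\<^sup>2\<close> satisfies, along every sample path,
  \<open>V (k + 1) \<le> (1 - \<gamma>) V k + \<alpha> \<parallel>w k\<parallel>\<^sup>2 - \<gamma> (d k \<bullet> w k)\<close> with \<open>d k\<close> measurable with respect to the
  past. In expectation the last term vanishes, and \<open>E \<parallel>w k\<parallel>\<^sup>2 \<le> \<nu>\<^sup>2 / N k \<le> \<nu>\<^sup>2 \<rho> ^ (k + 1)\<close> because
  distinct samples of one batch are uncorrelated. Hence \<open>E (V k)\<close> is at most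
  \<open>(1 - \<gamma>) ^ k E (V 0) + B \<rho> ^ k\<close> with \<open>B = \<alpha> \<nu>\<^sup>2 \<rho> / (\<rho> - (1 - \<gamma>))\<close>. Since \<open>1 - \<gamma> < \<rho>\<close>, the initial
  error is negligible as \<open>k \<rightarrow> \<infinity>\<close>, and \<open>B\<close> is bounded independently of \<open>L\<close> because
  \<open>\<alpha> / \<gamma> = \<gamma> / \<eta>\<close>; this makes the complexity constants independent of the condition number.
\<close>

section \<open>Strongly convex functions and the accelerated step\<close>

text \<open>Chain rule on a line. It serves the quadratic bounds below and, at \<open>t = 0\<close>,
  the measurability of \<open>gF\<close>.\<close>

lemma GDERIV_along_line:
  assumes "GDERIV f (v + t *\<^sub>R d) :> g"
  shows "((\<lambda>s. f (v + s *\<^sub>R d)) has_real_derivative g \<bullet> d) (at t)"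
proof -
  have "((\<lambda>s. v + s *\<^sub>R d) has_derivative (\<lambda>h. h *\<^sub>R d)) (at t)"
    by (auto intro!: derivative_eq_intros)
  from has_derivative_compose[OF this assms[unfolded gderiv_def]]
  have "((\<lambda>s. f (v + s *\<^sub>R d)) has_derivative (\<lambda>h. (h *\<^sub>R d) \<bullet> g)) (at t)" .
  moreover have "(\<lambda>h. (h *\<^sub>R d) \<bullet> g) = (*) (g \<bullet> d)"
    by (simp add: fun_eq_iff inner_commute)
  ultimately show ?thesis
    by (simp only: has_field_derivative_def)
qed

text \<open>On the segment from \<open>v\<close> to \<open>u\<close>, \<open>\<phi>\<close> is f
  minus the linear and quadratic terms of the bound; the one-sided hypothesis makes it
  nonincreasing. The sign of \<open>c\<close> is left open so that the lower bound can reuse this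
  for -f.\<close>

lemma quadratic_upper_bound:
  fixes f :: "'a::real_inner \<Rightarrow> real"
  assumes deriv: "\<And>u. GDERIV f u :> gf u"
    and mono: "\<And>u v. (gf u - gf v) \<bullet> (u - v) \<le> c * (norm (u - v))\<^sup>2"
  shows "f u \<le> f v + gf v \<bullet> (u - v) + c / 2 * (norm (u - v))\<^sup>2"
proof -
  define d where "d = u - v"
  define \<phi> where "\<phi> t = f (v + t *\<^sub>R d) - t * (gf v \<bullet> d) - c / 2 * t\<^sup>2 * (norm d)\<^sup>2" for t
  have "\<phi> 1 \<le> \<phi> 0"
  proof (rule DERIV_nonpos_imp_nonincreasing[where f = \<phi>])
    fix t :: real assume t: "0 \<le> t" "t \<le> 1"
    have "(\<phi> has_real_derivative (gf (v + t *\<^sub>R d) - gf v) \<bullet> d - c * t * (norm d)\<^sup>2) (at t)"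
      unfolding \<phi>_def
      by (auto intro!: derivative_eq_intros GDERIV_along_line deriv simp: inner_diff_left)
    moreover have "(gf (v + t *\<^sub>R d) - gf v) \<bullet> d \<le> c * t * (norm d)\<^sup>2"
    \<comment> \<open>The displacement from \<open>v\<close> is t times \<open>d\<close>, so the
      hypothesis yields the claim multiplied by t; cancelling t requires t > 0.\<close>
    proof (cases "t = 0")
      case False
      with t have "t > 0" by simp
      have "t * ((gf (v + t *\<^sub>R d) - gf v) \<bullet> d) \<le> t * (c * t * (norm d)\<^sup>2)"
        using mono[of "v + t *\<^sub>R d" v] by (simp add: power_mult_distrib power2_eq_square mult_ac)
      with \<open>t > 0\<close> show ?thesis by simp
    qed simp
    ultimately show "\<exists>D. (\<phi> has_real_derivative D) (at t) \<and> D \<le> 0"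
      by force
  qed simp
  then show ?thesis by (simp add: \<phi>_def d_def)
qed

lemma quadratic_lower_bound:
  fixes f :: "'a::real_inner \<Rightarrow> real"
  assumes deriv: "\<And>u. GDERIV f u :> gf u"
    and mono: "\<And>u v. c * (norm (u - v))\<^sup>2 \<le> (gf u - gf v) \<bullet> (u - v)"
  shows "f v + gf v \<bullet> (u - v) + c / 2 * (norm (u - v))\<^sup>2 \<le> f u"
proof -
  have "GDERIV (\<lambda>u. - f u) u :> - gf u" for u
    using deriv by (rule GDERIV_minus)
  moreover have "(- gf u - - gf v) \<bullet> (u - v) \<le> - c * (norm (u - v))\<^sup>2" for u v
    using mono[of u v] by (simp add: inner_diff_left)
  ultimately have "- f u \<le> - f v + - gf v \<bullet> (u - v) + - c / 2 * (norm (u - v))\<^sup>2"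
    by (rule quadratic_upper_bound)
  then show ?thesis by simp
qed

text \<open>The defect is exactly \<open>t * (1 - t) * (norm (a - b))\<^sup>2\<close>, which is
  nonnegative on the unit interval.\<close>

lemma norm_convex_combination_square:
  fixes a b :: "'a::real_inner"
  assumes "0 \<le> t" "t \<le> 1"
  shows "(norm ((1 - t) *\<^sub>R a + t *\<^sub>R b))\<^sup>2 \<le> (1 - t) * (norm a)\<^sup>2 + t * (norm b)\<^sup>2"
proof -
  have "(1 - t) * (norm a)\<^sup>2 + t * (norm b)\<^sup>2 - (norm ((1 - t) *\<^sub>R a + t *\<^sub>R b))\<^sup>2
      = t * (1 - t) * (norm (a - b))\<^sup>2"
    by (simp add: power2_norm_eq_inner inner_add_left inner_add_right inner_diff_left
        inner_diff_right inner_commute[of b a] algebra_simps)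
  then show ?thesis using assms by (metis diff_ge_0_iff_ge mult_nonneg_nonneg zero_le_power2)
qed

text \<open>Nesterov's potential argument with a gradient error \<open>e\<close>. Descent from
  \<open>x\<close>, convexity of the squared norm in the v-update, and the lower quadratic bounds at
  \<open>y\<close> and \<open>s\<close> are weighted so that every gradient term cancels. Descent
  and the v-update each leave half of the quadratic error term; only the v-update leaves a term
  linear in \<open>e\<close>.\<close>

lemma accelerated_lyapunov_step:
  fixes f :: "'a::real_inner \<Rightarrow> real"
  assumes lower: "\<And>u v. f v + gf v \<bullet> (u - v) + \<eta> / 2 * (norm (u - v))\<^sup>2 \<le> f u"
    and upper: "\<And>u v. f u \<le> f v + gf v \<bullet> (u - v) + L / 2 * (norm (u - v))\<^sup>2"
    and pos: "0 < \<eta>" "0 < \<alpha>" "\<alpha> * L \<le> 1"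
    and \<gamma>: "\<gamma>\<^sup>2 = \<alpha> * \<eta>" "0 \<le> \<gamma>" "\<gamma> \<le> 1"
    and x: "(1 + \<gamma>) *\<^sub>R x = y + \<gamma> *\<^sub>R v"
    and y': "y' = x - \<alpha> *\<^sub>R (gf x + e)"
    and v': "v' = (1 - \<gamma>) *\<^sub>R v + \<gamma> *\<^sub>R x - (\<gamma> / \<eta>) *\<^sub>R (gf x + e)"
  shows "f y' - f s + \<eta> / 2 * (norm (v' - s))\<^sup>2 \<le>
    (1 - \<gamma>) * (f y - f s + \<eta> / 2 * (norm (v - s))\<^sup>2) + \<alpha> * (norm e)\<^sup>2
      - \<gamma> * (((1 - \<gamma>) *\<^sub>R v + \<gamma> *\<^sub>R x - s - (\<gamma> / \<eta>) *\<^sub>R gf x) \<bullet> e)"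
proof -
  define g where "g = gf x"
  define a where "a = (1 - \<gamma>) *\<^sub>R (v - s) + \<gamma> *\<^sub>R (x - s)"
  have a: "(1 - \<gamma>) *\<^sub>R v + \<gamma> *\<^sub>R x - s = a"
    by (simp add: a_def algebra_simps)
  have "f y' \<le> f x - \<alpha> * (g \<bullet> (g + e)) + L / 2 * (\<alpha>\<^sup>2 * (norm (g + e))\<^sup>2)"
    using upper[of y' x] by (simp add: y' g_def power_mult_distrib)
  also have "L / 2 * (\<alpha>\<^sup>2 * (norm (g + e))\<^sup>2) \<le> \<alpha> / 2 * (norm (g + e))\<^sup>2"
    using mult_right_mono[OF pos(3), of "\<alpha> * (norm (g + e))\<^sup>2"] pos(2)
    by (simp add: power2_eq_square mult_ac)
  \<comment> \<open>The cross terms in g and e cancel: the linear part gives -\<alpha> and the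
    square of the step gives +\<alpha>.\<close>
  finally have fy': "f y' \<le> f x - \<alpha> / 2 * (norm g)\<^sup>2 + \<alpha> / 2 * (norm e)\<^sup>2"
    by (simp add: power2_norm_eq_inner inner_add_left inner_add_right inner_commute[of e g]
        algebra_simps)
  \<comment> \<open>The relation \<open>\<gamma>\<^sup>2 = \<alpha> * \<eta>\<close> enters here: it
    makes the squared gradient norm from the v-update equal to the one gained by descent.\<close>
  define t where "t = \<gamma> / \<eta>"
  have t: "\<eta> * t = \<gamma>" "\<eta> * t\<^sup>2 = \<alpha>"
    using pos(1) \<gamma>(1) by (simp_all add: t_def power_divide power2_eq_square)
  have v's_eq: "v' - s = a - t *\<^sub>R g - t *\<^sub>R e"
    by (simp add: v' a[symmetric] g_def t_def algebra_simps)
  have "(norm (a - p - q))\<^sup>2 = (norm a)\<^sup>2 - 2 * (a \<bullet> p) + (norm p)\<^sup>2 + (norm q)\<^sup>2 - 2 * ((a - p) \<bullet> q)"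
    for p q :: 'a
    by (simp add: power2_norm_eq_inner inner_diff_left inner_diff_right inner_commute)
  then have expand: "(norm (v' - s))\<^sup>2 = (norm a)\<^sup>2 - 2 * (t * (a \<bullet> g))
      + t\<^sup>2 * (norm g)\<^sup>2 + t\<^sup>2 * (norm e)\<^sup>2 - 2 * (t * ((a - t *\<^sub>R g) \<bullet> e))"
    unfolding v's_eq by (simp add: power_mult_distrib)
  have v's: "\<eta> / 2 * (norm (v' - s))\<^sup>2 = \<eta> / 2 * (norm a)\<^sup>2 - \<gamma> * (a \<bullet> g)
      + \<alpha> / 2 * (norm g)\<^sup>2 + \<alpha> / 2 * (norm e)\<^sup>2 - \<gamma> * ((a - t *\<^sub>R g) \<bullet> e)"
    unfolding expand t(1)[symmetric] t(2)[symmetric] by (simp add: right_diff_distrib distrib_left)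
  have na0: "(norm a)\<^sup>2 \<le> (1 - \<gamma>) * (norm (v - s))\<^sup>2 + \<gamma> * (norm (x - s))\<^sup>2"
    unfolding a_def using \<gamma>(2,3) by (rule norm_convex_combination_square)
  have na: "\<eta> / 2 * (norm a)\<^sup>2
      \<le> (1 - \<gamma>) * (\<eta> / 2 * (norm (v - s))\<^sup>2) + \<gamma> * (\<eta> / 2 * (norm (x - s))\<^sup>2)"
    using mult_left_mono[OF na0, of "\<eta> / 2"] pos(1)
    unfolding distrib_left mult.left_commute[of "\<eta> / 2"] by simp
  have "f x + g \<bullet> (y - x) \<le> f y"
    using lower[of x y] pos(1) zero_le_power2[of "norm (y - x)"]
    by (smt (verit) g_def divide_nonneg_pos mult_nonneg_nonneg)
  then have fy: "(1 - \<gamma>) * (f x + g \<bullet> (y - x)) \<le> (1 - \<gamma>) * f y"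
    using \<gamma>(3) by (intro mult_left_mono) auto
  have fs: "\<gamma> * (f x + g \<bullet> (s - x) + \<eta> / 2 * (norm (x - s))\<^sup>2) \<le> \<gamma> * f s"
    using lower[of x s] \<gamma>(2) by (intro mult_left_mono) (auto simp: g_def norm_minus_commute)
  have y: "y = (1 + \<gamma>) *\<^sub>R x - \<gamma> *\<^sub>R v" using x by simp
  \<comment> \<open>Since \<open>x\<close> balances \<open>y\<close> and \<open>v\<close>, the three
    directions paired with the gradient cancel in exactly the weights of \<open>fy\<close>,
    \<open>fs\<close> and \<open>v's\<close>.\<close>
  have "(1 - \<gamma>) *\<^sub>R (y - x) + \<gamma> *\<^sub>R (s - x) + \<gamma> *\<^sub>R a = 0"
    unfolding y by (simp add: a_def algebra_simps)
  from arg_cong[OF this, of "\<lambda>u. g \<bullet> u"]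
  have zero: "(1 - \<gamma>) * (g \<bullet> (y - x)) + \<gamma> * (g \<bullet> (s - x)) + \<gamma> * (a \<bullet> g) = 0"
    by (simp add: inner_add_right inner_commute)
  \<comment> \<open>With norms, inner products and function values replaced by real variables, the
    sum of the estimates is plain arithmetic.\<close>
  have combine: "Y' - S + V' \<le> (1 - \<gamma>) * (Y - S + V) + \<alpha> * E - \<gamma> * C"
    if "Y' \<le> X - \<alpha> / 2 * G + \<alpha> / 2 * E" "V' = A - \<gamma> * P + \<alpha> / 2 * G + \<alpha> / 2 * E - \<gamma> * C"
      "A \<le> (1 - \<gamma>) * V + \<gamma> * W" "(1 - \<gamma>) * (X + Q) \<le> (1 - \<gamma>) * Y"
      "\<gamma> * (X + R + W) \<le> \<gamma> * S" "(1 - \<gamma>) * Q + \<gamma> * R + \<gamma> * P = 0"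
    for A C E G P Q R S V V' W X Y Y' :: real
    using that by (simp add: algebra_simps)
  show ?thesis
    unfolding a g_def[symmetric] t_def[symmetric]
    by (rule combine[OF fy' v's na fy fs zero])
qed

section \<open>Square-integrable random vectors\<close>

definition square_integrable :: "'w measure \<Rightarrow> ('w \<Rightarrow> 'a::euclidean_space) \<Rightarrow> bool" where
  "square_integrable M X \<longleftrightarrow> X \<in> borel_measurable M \<and> integrable M (\<lambda>w. (norm (X w))\<^sup>2)"

lemma square_integrable_measurable:
  "square_integrable M X \<Longrightarrow> X \<in> borel_measurable M"
  by (simp add: square_integrable_def)

lemma square_integrable_inner:
  assumes "square_integrable M X" "square_integrable M Y"
  shows "integrable M (\<lambda>w. X w \<bullet> Y w)"
proof (rule Bochner_Integration.integrable_bound)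
  show "integrable M (\<lambda>w. (norm (X w))\<^sup>2 + (norm (Y w))\<^sup>2)"
    using assms by (simp add: square_integrable_def)
  show "(\<lambda>w. X w \<bullet> Y w) \<in> borel_measurable M"
    using assms by (auto simp: square_integrable_def)
  have "\<bar>X w \<bullet> Y w\<bar> \<le> (norm (X w))\<^sup>2 + (norm (Y w))\<^sup>2" for w
    using Cauchy_Schwarz_ineq2[of "X w" "Y w"] sum_squares_bound[of "norm (X w)" "norm (Y w)"]
      mult_nonneg_nonneg[of "norm (X w)" "norm (Y w)"]
    by (simp only: norm_ge_zero)
  then show "AE w in M. norm (X w \<bullet> Y w) \<le> norm ((norm (X w))\<^sup>2 + (norm (Y w))\<^sup>2)"
    by (auto simp: abs_of_nonneg)
qed

lemma square_integrable_add:
  assumes "square_integrable M X" "square_integrable M Y"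
  shows "square_integrable M (\<lambda>w. X w + Y w)"
proof -
  have "(norm (X w + Y w))\<^sup>2 = (norm (X w))\<^sup>2 + (norm (Y w))\<^sup>2 + 2 * (X w \<bullet> Y w)" for w
    by (simp add: power2_norm_eq_inner inner_add_left inner_add_right inner_commute)
  then show ?thesis
    using assms square_integrable_inner[OF assms] by (auto simp: square_integrable_def)
qed

lemma square_integrable_scaleR:
  "square_integrable M X \<Longrightarrow> square_integrable M (\<lambda>w. c *\<^sub>R X w)"
  by (auto simp: square_integrable_def power_mult_distrib)

lemma square_integrable_diff:
  assumes "square_integrable M X" "square_integrable M Y"
  shows "square_integrable M (\<lambda>w. X w - Y w)"
  using square_integrable_add[OF assms(1) square_integrable_scaleR[OF assms(2), of "-1"]] by simp

lemma square_integrable_sum: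
  assumes "\<And>i. i \<in> I \<Longrightarrow> square_integrable M (X i)"
  shows "square_integrable M (\<lambda>w. \<Sum>i\<in>I. X i w)"
  using assms
  by (induction I rule: infinite_finite_induct)
    (auto intro!: square_integrable_add simp: square_integrable_def[of M "\<lambda>_. 0"])

lemma square_integrable_cong:
  assumes "\<And>w. w \<in> space M \<Longrightarrow> X w = Y w"
  shows "square_integrable M X \<longleftrightarrow> square_integrable M Y"
  using assms unfolding square_integrable_def
  by (metis (no_types, lifting) measurable_cong Bochner_Integration.integrable_cong)

lemma square_integrable_component:
  fixes X :: "'w \<Rightarrow> real^'m"
  assumes "square_integrable M X"
  shows "square_integrable M (\<lambda>w. X w $ c)"
  unfolding square_integrable_def
proof
  show m: "(\<lambda>w. X w $ c) \<in> borel_measurable M"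
    unfolding cart_eq_inner_axis using square_integrable_measurable[OF assms] by measurable
  show "integrable M (\<lambda>w. (norm (X w $ c))\<^sup>2)"
  proof (rule Bochner_Integration.integrable_bound)
    show "integrable M (\<lambda>w. (norm (X w))\<^sup>2)" using assms by (simp add: square_integrable_def)
    show "(\<lambda>w. (norm (X w $ c))\<^sup>2) \<in> borel_measurable M" using m by measurable
    show "AE w in M. norm ((norm (X w $ c))\<^sup>2) \<le> norm ((norm (X w))\<^sup>2)"
      using power_mono[OF component_le_norm_cart abs_ge_zero, where n = 2] by auto
  qed
qed

lemma (in finite_measure) square_integrable_const: "square_integrable M (\<lambda>_. c)"
  by (simp add: square_integrable_def)

lemma (in finite_measure) square_integrable_imp_integrable_real:
  fixes X :: "'a \<Rightarrow> real"
  assumes "square_integrable M X" shows "integrable M X"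
  using square_integrable_inner[OF assms square_integrable_const[of "1::real"]] by simp

text \<open>The difference \<open>g (X w) - g 0\<close> is dominated by L times the norm of
  \<open>X w\<close>, and constants are square integrable on a finite measure space.\<close>

lemma (in finite_measure) square_integrable_lipschitz:
  fixes X :: "'a \<Rightarrow> 'b::euclidean_space" and g :: "'b \<Rightarrow> 'c::euclidean_space"
  assumes X: "square_integrable M X"
    and g: "continuous_on UNIV g" "\<And>u v. norm (g u - g v) \<le> L * norm (u - v)"
  shows "square_integrable M (\<lambda>w. g (X w))"
proof -
  have [measurable]: "g \<in> borel_measurable borel" using g(1) by (rule borel_measurable_continuous_onI)
  have [measurable]: "X \<in> borel_measurable M" using X by (rule square_integrable_measurable)
  have "square_integrable M (\<lambda>w. g (X w) - g 0)"
    unfolding square_integrable_def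
  proof
    show "integrable M (\<lambda>w. (norm (g (X w) - g 0))\<^sup>2)"
    proof (rule Bochner_Integration.integrable_bound)
      show "integrable M (\<lambda>w. L\<^sup>2 * (norm (X w))\<^sup>2)" using X by (simp add: square_integrable_def)
      show "AE w in M. norm ((norm (g (X w) - g 0))\<^sup>2) \<le> norm (L\<^sup>2 * (norm (X w))\<^sup>2)"
        using power_mono[OF g(2)[of _ 0] norm_ge_zero, where n = 2] by (simp add: power_mult_distrib)
    qed measurable
  qed measurable
  from square_integrable_add[OF this square_integrable_const[of "g 0"]] show ?thesis by simp
qed

text \<open>The measurable factor is pulled out of the conditional expectation. Integrability is
  asked of the product alone, which is what Fubini supplies for a frozen factor below.\<close>

lemma (in sigma_finite_subalgebra) integral_mult_eq_0_if_cond_exp_eq_0: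
  assumes "AE w in M. real_cond_exp M F g w = 0" "g \<in> borel_measurable M"
    and "f \<in> borel_measurable F" "integrable M (\<lambda>w. f w * g w)"
  shows "(\<integral>w. f w * g w \<partial>M) = 0"
proof -
  have "(\<integral>w. f w * g w \<partial>M) = (\<integral>w. f w * real_cond_exp M F g w \<partial>M)"
    using assms by (simp add: real_cond_exp_intg(2))
  also have "\<dots> = (\<integral>w. 0 \<partial>M)"
    using assms(1,2) measurable_from_subalg[OF subalg assms(3)]
    by (intro integral_cong_AE) auto
  finally show ?thesis by simp
qed

text \<open>The library notion \<open>indep_var\<close> forces both random variables to have values in the same type.\<close>

lemma (in prob_space) distr_pair_if_indep_set:
  assumes A[measurable]: "random_variable S A" and B[measurable]: "random_variable T B"
    and indep: "indep_set {A -` P \<inter> space M | P. P \<in> sets S} {B -` Q \<inter> space M | Q. Q \<in> sets T}"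
  shows "distr M S A \<Otimes>\<^sub>M distr M T B = distr M (S \<Otimes>\<^sub>M T) (\<lambda>w. (A w, B w))"
proof -
  interpret A: prob_space "distr M S A" using A by (rule prob_space_distr)
  interpret B: prob_space "distr M T B" using B by (rule prob_space_distr)
  show ?thesis
  proof (rule pair_measure_eqI)
    fix P Q assume "P \<in> sets (distr M S A)" "Q \<in> sets (distr M T B)"
    then have [measurable]: "P \<in> sets S" "Q \<in> sets T" by auto
    have "prob ((A -` P \<inter> space M) \<inter> (B -` Q \<inter> space M))
        = prob (A -` P \<inter> space M) * prob (B -` Q \<inter> space M)"
      by (rule indep_setD[OF indep]) (use \<open>P \<in> sets S\<close> \<open>Q \<in> sets T\<close> in auto)
    moreover have "(\<lambda>w. (A w, B w)) -` (P \<times> Q) \<inter> space M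
        = (A -` P \<inter> space M) \<inter> (B -` Q \<inter> space M)" by auto
    ultimately show "emeasure (distr M S A) P * emeasure (distr M T B) Q
        = emeasure (distr M (S \<Otimes>\<^sub>M T) (\<lambda>w. (A w, B w))) (P \<times> Q)"
      by (simp add: emeasure_distr emeasure_eq_measure ennreal_mult)
  qed (simp_all add: A.sigma_finite_measure_axioms B.sigma_finite_measure_axioms cong: sets_pair_measure_cong)
qed

text \<open>Conditioning on \<open>G\<close> alone suffices: by independence of \<open>B\<close>, Fubini freezes its value, after which
  \<open>\<phi> (X w, b)\<close> is measurable with respect to \<open>G\<close>.\<close>

lemma (in prob_space) integral_mult_freeze_eq_0:
  fixes g :: "'a \<Rightarrow> real"
  assumes sub: "subalgebra M G"
    and X: "X \<in> measurable G S"
    and g: "AE w in M. real_cond_exp M G g w = 0"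
    and gm[measurable]: "g \<in> borel_measurable M" and rvB[measurable]: "random_variable T B"
    and indep: "indep_set {(\<lambda>w. (X w, g w)) -` P \<inter> space M | P. P \<in> sets (S \<Otimes>\<^sub>M borel)}
      {B -` Q \<inter> space M | Q. Q \<in> sets T}"
    and \<phi>: "\<phi> \<in> borel_measurable (S \<Otimes>\<^sub>M T)"
    and int: "integrable M (\<lambda>w. \<phi> (X w, B w) * g w)"
  shows "expectation (\<lambda>w. \<phi> (X w, B w) * g w) = 0"
proof -
  interpret sub: sigma_finite_subalgebra M G
    using sub by (intro finite_measure_subalgebra_is_sigma_finite)
      (simp add: finite_measure_subalgebra_def finite_measure_subalgebra_axioms_def finite_measure_axioms)
  have [measurable]: "X \<in> measurable M S"
    using sub X by (rule measurable_from_subalg)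
  have rvA[measurable]: "random_variable (S \<Otimes>\<^sub>M borel) (\<lambda>w. (X w, g w))" by simp
  note eq = distr_pair_if_indep_set[OF rvA rvB indep]
  note \<phi>[measurable]
  define PA where "PA = distr M (S \<Otimes>\<^sub>M borel) (\<lambda>w. (X w, g w))"
  define PB where "PB = distr M T B"
  interpret PA: prob_space PA unfolding PA_def by (rule prob_space_distr) simp
  interpret PB: prob_space PB unfolding PB_def by (rule prob_space_distr) simp
  interpret pair_sigma_finite PA PB ..
  define \<psi> where "\<psi> = (\<lambda>p. \<phi> (fst (fst p), snd p) * snd (fst p))"
  have \<psi>[measurable]: "\<psi> \<in> borel_measurable ((S \<Otimes>\<^sub>M borel) \<Otimes>\<^sub>M T)"
    unfolding \<psi>_def by measurable
  have int\<psi>: "integrable (PA \<Otimes>\<^sub>M PB) (\<lambda>(a, b). \<psi> (a, b))"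
    unfolding PA_def PB_def eq using int by (subst integrable_distr_eq) (auto simp: \<psi>_def)
  have "expectation (\<lambda>w. \<phi> (X w, B w) * g w) = (\<integral>p. \<psi> p \<partial>(PA \<Otimes>\<^sub>M PB))"
    unfolding PA_def PB_def eq by (subst integral_distr) (auto simp: \<psi>_def)
  also have "\<dots> = (\<integral>b. (\<integral>a. \<psi> (a, b) \<partial>PA) \<partial>PB)"
    using integral_snd[of "\<lambda>a b. \<psi> (a, b)"] int\<psi> by simp
  also have "\<dots> = (\<integral>b. 0 \<partial>PB)"
  proof (rule integral_cong_AE)
    show "AE b in PB. (\<integral>a. \<psi> (a, b) \<partial>PA) = 0"
      using AE_integrable_snd[OF int\<psi>] AE_space
    proof eventually_elim
      case (elim b)
      then have [measurable]: "b \<in> space T" by (simp add: PB_def)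
      from elim(1) have i: "integrable M (\<lambda>w. \<phi> (X w, b) * g w)"
        unfolding PA_def by (subst (asm) integrable_distr_eq) (auto simp: \<psi>_def)
      have "(\<lambda>w. \<phi> (X w, b)) \<in> borel_measurable G"
        using X by measurable
      from sub.integral_mult_eq_0_if_cond_exp_eq_0[OF g gm this i]
      show ?case
        unfolding PA_def by (subst integral_distr) (auto simp: \<psi>_def)
    qed
    show "(\<lambda>b. \<integral>a. \<psi> (a, b) \<partial>PA) \<in> borel_measurable PB"
      using integrable_snd[OF int\<psi>] by auto
  qed simp
  finally show ?thesis by simp
qed

section \<open>Variance of the averaged gradient noise\<close>

lemma rv_sigma_eq: "rv_sigma M X = {X -` A \<inter> space M | A. A \<in> sets borel}"
  unfolding rv_sigma_def by (rule sets_vimage_algebra2) simp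

lemma measurable_if_rv_sigma_subset:
  assumes "rv_sigma M X \<subseteq> sets G" "space G = space M"
  shows "X \<in> borel_measurable G"
  using assms unfolding rv_sigma_eq by (intro measurableI) auto

context stochastic_problem
begin

text \<open>Each component is a pointwise limit of difference quotients of \<open>F\<close> with
  increments \<open>1 / (n + 1)\<close>, and these are jointly measurable because \<open>F\<close>
  is.\<close>

lemma measurable_gF: "case_prod gF \<in> borel_measurable (borel \<Otimes>\<^sub>M borel)"
  unfolding borel_measurable_euclidean_space[of "case_prod gF"]
proof
  fix i :: "real^'m" assume "i \<in> Basis"
  define q where "q n p = (case_prod F (fst p + inverse (real (Suc n)) *\<^sub>R i, snd p) - case_prod F p)
    / inverse (real (Suc n))" for n and p :: "(real^'m) \<times> (real^'d)"
  show "(\<lambda>p. case_prod gF p \<bullet> i) \<in> borel_measurable (borel \<Otimes>\<^sub>M borel)"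
  proof (rule borel_measurable_LIMSEQ_real)
    show "q n \<in> borel_measurable (borel \<Otimes>\<^sub>M borel)" for n
      unfolding q_def using F_measurable by measurable
    fix p :: "(real^'m) \<times> (real^'d)"
    obtain u z where p: "p = (u, z)" by (cases p)
    have "((\<lambda>s. F (u + s *\<^sub>R i) z) has_real_derivative gF u z \<bullet> i) (at 0)"
      using F_gradient[of z u] by (intro GDERIV_along_line) simp
    then have "((\<lambda>h. (F (u + h *\<^sub>R i) z - F u z) / h) \<longlongrightarrow> gF u z \<bullet> i) (at 0)"
      by (simp add: DERIV_def)
    moreover have "filterlim (\<lambda>n. inverse (real (Suc n))) (at 0) sequentially"
      by (intro filterlim_atI LIMSEQ_inverse_real_of_nat) simp
    ultimately have "(\<lambda>n. (F (u + inverse (real (Suc n)) *\<^sub>R i) z - F u z) / inverse (real (Suc n)))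
        \<longlonglongrightarrow> gF u z \<bullet> i"
      by (rule filterlim_compose)
    then show "(\<lambda>n. q n p) \<longlonglongrightarrow> case_prod gF p \<bullet> i"
      by (simp add: q_def p)
  qed
qed

end

context accelerated_sgd
begin

abbreviation past :: "nat \<Rightarrow> 'w measure" where
  "past k \<equiv> history M N (x 0) xi k"

definition dev :: "nat \<Rightarrow> nat \<Rightarrow> 'w \<Rightarrow> real^'m" where
  "dev j k w = gF (x k w) (xi j k w) - gf (x k w)"

abbreviation noise :: "nat \<Rightarrow> 'w \<Rightarrow> real^'m" where
  "noise k \<equiv> grad_noise gF gf N xi x k"

lemma batch_indexI: "j \<in> {1..N k} \<Longrightarrow> (j, k) \<in> batch_indices N"
  by (simp add: batch_indices_def)

section \<open>Measurability of the iterates and the sigma-algebra of the past\<close>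

lemma measurable_gf: "gf \<in> borel_measurable borel"
  using gf_continuous by (rule borel_measurable_continuous_onI)

lemma measurable_f: "f \<in> borel_measurable borel"
  using f_gradient unfolding gderiv_def
  by (intro borel_measurable_continuous_onI)
    (auto intro!: continuous_at_imp_continuous_on dest: has_derivative_continuous)

text \<open>The sigma-algebra \<open>G\<close> is arbitrary because two choices are needed: the past
  itself, and the past enlarged by one sample of the current step.\<close>

lemma iterates_measurable:
  assumes "space G = space M" "x 0 \<in> borel_measurable G"
    and "\<And>j t. (j, t) \<in> batch_indices N \<Longrightarrow> t < k \<Longrightarrow> xi j t \<in> borel_measurable G"
  shows "x k \<in> borel_measurable G" "y k \<in> borel_measurable G"
proof -
  have "x k \<in> borel_measurable G \<and> y k \<in> borel_measurable G"
    using assms(3)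
  proof (induction k)
    case 0
    have "y 0 \<in> borel_measurable G \<longleftrightarrow> x 0 \<in> borel_measurable G"
      using start assms(1) by (intro measurable_cong) auto
    then show ?case using assms(2) by simp
  next
    case (Suc k)
    then have [measurable]: "x k \<in> borel_measurable G" "y k \<in> borel_measurable G" by auto
    note measurable_gf[measurable]
    have [measurable]: "(\<lambda>w. gF (x k w) (xi j k w)) \<in> borel_measurable G" if "j \<in> {1..N k}" for j
    proof -
      have "xi j k \<in> borel_measurable G" using Suc.prems that batch_indexI by blast
      then have "(\<lambda>w. (x k w, xi j k w)) \<in> measurable G (borel \<Otimes>\<^sub>M borel)" by measurable
      from measurable_compose[OF this measurable_gF] show ?thesis by simp
    qed
    have "(\<lambda>w. x k w - \<alpha> *\<^sub>R (gf (x k w) + noise k w)) \<in> borel_measurable G"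
      unfolding grad_noise_def by measurable
    moreover have "y (Suc k) \<in> borel_measurable G \<longleftrightarrow>
        (\<lambda>w. x k w - \<alpha> *\<^sub>R (gf (x k w) + noise k w)) \<in> borel_measurable G"
      using y_step assms(1) by (intro measurable_cong) auto
    ultimately have y[measurable]: "y (Suc k) \<in> borel_measurable G" by simp
    have "x (Suc k) \<in> borel_measurable G \<longleftrightarrow>
        (\<lambda>w. y (Suc k) w + \<beta> *\<^sub>R (y (Suc k) w - y k w)) \<in> borel_measurable G"
      using x_step assms(1) by (intro measurable_cong) auto
    then show ?case using y by simp
  qed
  then show "x k \<in> borel_measurable G" "y k \<in> borel_measurable G" by auto
qed

lemma history_generators:
  "rv_sigma M (x 0) \<union> (\<Union>(j, t) \<in> {(j, t) \<in> batch_indices N. t < k}. rv_sigma M (xi j t)) \<subseteq> Pow (space M)"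
  by (auto simp: rv_sigma_eq)

lemma space_past: "space (past k) = space M"
  unfolding history_def using history_generators by (rule space_measure_of)

lemma sets_past: "sets (past k) = sigma_sets (space M)
    (rv_sigma M (x 0) \<union> (\<Union>(j, t) \<in> {(j, t) \<in> batch_indices N. t < k}. rv_sigma M (xi j t)))"
  unfolding history_def using history_generators by (rule sets_measure_of)

lemma subalgebra_past: "subalgebra M (past k)"
  unfolding subalgebra_def space_past sets_past
proof (intro conjI refl sets.sigma_sets_subset)
  show "rv_sigma M (x 0) \<union> (\<Union>(j, t) \<in> {(j, t) \<in> batch_indices N. t < k}. rv_sigma M (xi j t)) \<subseteq> sets M"
    using measurable_sets[OF initial_rv] measurable_sets[OF sample_rv] by (auto simp: rv_sigma_eq)
qed

lemma sigma_finite_past: "sigma_finite_subalgebra M (past k)"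
  using subalgebra_past by (intro finite_measure_subalgebra_is_sigma_finite)
    (simp add: finite_measure_subalgebra_def finite_measure_subalgebra_axioms_def finite_measure_axioms)

lemma x_past: "x k \<in> borel_measurable (past k)" and y_past: "y k \<in> borel_measurable (past k)"
proof -
  have "x 0 \<in> borel_measurable (past k)"
    by (rule measurable_if_rv_sigma_subset) (auto simp: space_past sets_past)
  moreover have "xi j t \<in> borel_measurable (past k)" if "(j, t) \<in> batch_indices N" "t < k" for j t
    using that by (intro measurable_if_rv_sigma_subset) (auto simp: space_past sets_past)
  ultimately show "x k \<in> borel_measurable (past k)" "y k \<in> borel_measurable (past k)"
    using iterates_measurable[OF space_past] by blast+
qed

lemma x_rv: "x k \<in> borel_measurable M" and y_rv: "y k \<in> borel_measurable M"
  using x_past y_past subalgebra_past measurable_from_subalg by blast+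

lemma measurable_deviation:
  assumes "X \<in> borel_measurable G" "Z \<in> borel_measurable G"
  shows "(\<lambda>w. gF (X w) (Z w) - gf (X w)) \<in> borel_measurable G"
proof -
  have "(\<lambda>w. (X w, Z w)) \<in> measurable G (borel \<Otimes>\<^sub>M borel)" using assms by measurable
  from measurable_compose[OF this measurable_gF]
  have [measurable]: "(\<lambda>w. gF (X w) (Z w)) \<in> borel_measurable G" by simp
  note assms(1)[measurable] measurable_gf[measurable]
  show ?thesis by measurable
qed

section \<open>Square integrability of the noise and of the iterates\<close>

lemma dev_rv: "(j, k) \<in> batch_indices N \<Longrightarrow> dev j k \<in> borel_measurable M"
  unfolding dev_def[abs_def] by (intro measurable_deviation x_rv sample_rv)

text \<open>Integrating \<open>nn_cond_exp\<close> gives back the second moment as an extended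
  integral, so the variance bound yields integrability and the numerical bound at once.\<close>

lemma dev_square_integrable: "(j, k) \<in> batch_indices N \<Longrightarrow> square_integrable M (dev j k)"
  and dev_second_moment: "(j, k) \<in> batch_indices N \<Longrightarrow> expectation (\<lambda>w. (norm (dev j k w))\<^sup>2) \<le> \<nu>\<^sup>2"
proof -
  assume jk: "(j, k) \<in> batch_indices N"
  note [measurable] = dev_rv[OF jk]
  interpret past: sigma_finite_subalgebra M "past k" by (rule sigma_finite_past)
  let ?g = "\<lambda>w. ennreal ((norm (dev j k w))\<^sup>2)"
  have "(\<integral>\<^sup>+ w. ?g w \<partial>M) = (\<integral>\<^sup>+ w. nn_cond_exp M (past k) ?g w \<partial>M)"
    using past.nn_cond_exp_intg[of "\<lambda>_. 1" ?g] by simp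
  also have "\<dots> \<le> (\<integral>\<^sup>+ w. ennreal (\<nu>\<^sup>2) \<partial>M)"
    using variance_bound[OF jk] unfolding dev_def by (rule nn_integral_mono_AE)
  also have "\<dots> = ennreal (\<nu>\<^sup>2)" by (simp add: emeasure_space_1)
  finally have le: "(\<integral>\<^sup>+ w. ?g w \<partial>M) \<le> ennreal (\<nu>\<^sup>2)" .
  then have "(\<integral>\<^sup>+ w. ?g w \<partial>M) < \<infinity>" by (rule le_less_trans) simp
  then have i: "integrable M (\<lambda>w. (norm (dev j k w))\<^sup>2)"
    by (intro integrableI_nonneg) auto
  then show "square_integrable M (dev j k)" by (simp add: square_integrable_def)
  show "expectation (\<lambda>w. (norm (dev j k w))\<^sup>2) \<le> \<nu>\<^sup>2"
    using le nn_integral_eq_integral[OF i] by simp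
qed

lemma noise_eq: "noise k w = (1 / real (N k)) *\<^sub>R (\<Sum>j=1..N k. dev j k w)"
proof -
  have "real (N k) \<noteq> 0" using batch_pos[of k] by simp
  then show ?thesis
    by (simp add: grad_noise_def dev_def sum_subtractf scaleR_diff_right sum_constant_scaleR del: sum_constant)
qed

lemma noise_square_integrable: "square_integrable M (noise k)"
proof -
  have "square_integrable M (\<lambda>w. (1 / real (N k)) *\<^sub>R (\<Sum>j=1..N k. dev j k w))"
    by (intro square_integrable_scaleR square_integrable_sum dev_square_integrable batch_indexI)
  then show ?thesis by (simp add: noise_eq[abs_def])
qed

lemma gf_square_integrable: "square_integrable M X \<Longrightarrow> square_integrable M (\<lambda>w. gf (X w))"
  by (rule square_integrable_lipschitz[OF _ gf_continuous gf_lipschitz])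

lemma x_square_integrable: "square_integrable M (x k)"
  and y_square_integrable: "square_integrable M (y k)"
proof -
  have "square_integrable M (x k) \<and> square_integrable M (y k)"
  proof (induction k)
    case 0
    have "square_integrable M (x 0)"
      using initial_rv initial_L2 by (simp add: square_integrable_def)
    then show ?case using square_integrable_cong[of M "x 0" "y 0"] start by simp
  next
    case (Suc k)
    have "square_integrable M (\<lambda>w. x k w - \<alpha> *\<^sub>R (gf (x k w) + noise k w))"
      using Suc by (intro square_integrable_diff square_integrable_scaleR square_integrable_add
          gf_square_integrable noise_square_integrable) auto
    then have y: "square_integrable M (y (Suc k))"
      using square_integrable_cong[of M "y (Suc k)", OF y_step] by simp
    then have "square_integrable M (\<lambda>w. y (Suc k) w + \<beta> *\<^sub>R (y (Suc k) w - y k w))"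
      using Suc by (intro square_integrable_diff square_integrable_scaleR square_integrable_add) auto
    then have "square_integrable M (x (Suc k))"
      using square_integrable_cong[of M "x (Suc k)", OF x_step] by simp
    with y show ?case by simp
  qed
  then show "square_integrable M (x k)" "square_integrable M (y k)" by auto
qed

section \<open>Orthogonality of the noise to the past and within a batch\<close>

lemma dev_cond_exp:
  assumes jk: "(j, k) \<in> batch_indices N"
  shows "AE w in M. real_cond_exp M (past k) (\<lambda>w. dev j k w $ c) w = 0"
proof -
  interpret past: sigma_finite_subalgebra M "past k" by (rule sigma_finite_past)
  have gfx: "integrable M (\<lambda>w. gf (x k w) $ c)"
    by (intro square_integrable_imp_integrable_real square_integrable_component
        gf_square_integrable x_square_integrable)
  have d: "integrable M (\<lambda>w. dev j k w $ c)"
    by (intro square_integrable_imp_integrable_real square_integrable_component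
        dev_square_integrable jk)
  \<comment> \<open>Integrability of the sampled gradient is recovered from \<open>dev\<close> and
    \<open>gf (x k)\<close>; it makes the conditional expectation additive.\<close>
  have gF: "integrable M (\<lambda>w. gF (x k w) (xi j k w) $ c)"
    using Bochner_Integration.integrable_add[OF d gfx] by (simp add: dev_def)
  have "(\<lambda>w. gf (x k w)) \<in> borel_measurable (past k)"
    using x_past measurable_gf by (rule measurable_compose)
  then have "(\<lambda>w. gf (x k w) $ c) \<in> borel_measurable (past k)"
    unfolding cart_eq_inner_axis by measurable
  from past.real_cond_exp_F_meas[OF gfx this] past.real_cond_exp_diff[OF gF gfx] unbiased[OF jk]
  show ?thesis
    by eventually_elim (auto simp: dev_def vec_cond_exp_def vec_eq_iff)
qed

lemma integral_inner_dev_eq_0: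
  assumes jk: "(j, k) \<in> batch_indices N"
    and Z: "Z \<in> borel_measurable (past k)" "square_integrable M Z"
  shows "expectation (\<lambda>w. Z w \<bullet> dev j k w) = 0"
proof -
  interpret past: sigma_finite_subalgebra M "past k" by (rule sigma_finite_past)
  have d: "square_integrable M (\<lambda>w. dev j k w $ c)" for c
    by (intro square_integrable_component dev_square_integrable jk)
  have i: "integrable M (\<lambda>w. Z w $ c * dev j k w $ c)" for c
    using square_integrable_inner[OF square_integrable_component[OF Z(2)] d] by simp
  have "expectation (\<lambda>w. Z w $ c * dev j k w $ c) = 0" for c
  proof (rule past.integral_mult_eq_0_if_cond_exp_eq_0[OF dev_cond_exp[OF jk] _ _ i])
    show "(\<lambda>w. Z w $ c) \<in> borel_measurable (past k)"
      using Z(1) unfolding cart_eq_inner_axis by measurable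
  qed (rule square_integrable_measurable[OF d])
  then show ?thesis
    using i by (simp add: inner_vec_def)
qed

lemma integral_inner_noise_eq_0:
  assumes Z: "Z \<in> borel_measurable (past k)" "square_integrable M Z"
  shows "expectation (\<lambda>w. Z w \<bullet> noise k w) = 0"
proof -
  have "expectation (\<lambda>w. Z w \<bullet> dev j k w) = 0" "integrable M (\<lambda>w. Z w \<bullet> dev j k w)"
    if "j \<in> {1..N k}" for j
    using integral_inner_dev_eq_0[OF batch_indexI[OF that] Z]
      square_integrable_inner[OF Z(2) dev_square_integrable[OF batch_indexI[OF that]]] .
  then show ?thesis
    by (simp add: noise_eq inner_sum_right)
qed

text \<open>Disjoint blocks of an independent family generate independent sigma-algebras. One block
  holds the initial point, all earlier samples and sample \<open>j\<close> of step \<open>k\<close>,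
  which determine the pair; the other holds sample \<open>i\<close> alone.\<close>

lemma indep_past_dev_sample:
  assumes ij: "(i, k) \<in> batch_indices N" "(j, k) \<in> batch_indices N" "i \<noteq> j"
  shows "indep_set {(\<lambda>w. (x k w, dev j k w $ c)) -` P \<inter> space M | P. P \<in> sets (borel \<Otimes>\<^sub>M borel)}
    {xi i k -` Q \<inter> space M | Q. Q \<in> sets borel}"
proof -
  define E where "E = case_option (rv_sigma M (x 0)) (\<lambda>(j, k). rv_sigma M (xi j k))"
  define I where "I = (\<lambda>b. if b then insert None (Some ` {(a, t) \<in> batch_indices N. t < k \<or> (a, t) = (j, k)})
    else {Some (i, k)})"
  have E_Pow: "E o' \<subseteq> Pow (space M)" for o'
    by (auto simp: E_def rv_sigma_eq split: option.splits)
  have "indep_sets (\<lambda>b. sigma_sets (space M) (\<Union>o'\<in>I b. E o')) UNIV"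
  proof (rule indep_sets_collect_sigma)
    show "indep_sets E (\<Union>b\<in>UNIV. I b)"
      by (rule indep_sets_mono_index[OF _ independence[folded E_def]])
        (use ij in \<open>auto simp: I_def split: if_splits\<close>)
    show "Int_stable (E o')" for o'
      by (auto simp: E_def rv_sigma_def sets.Int_stable split: option.splits)
    show "disjoint_family_on I UNIV"
      using ij by (auto simp: disjoint_family_on_def I_def)
  qed
  then have ind: "indep_set (sigma_sets (space M) (\<Union>o'\<in>I True. E o')) (sigma_sets (space M) (\<Union>o'\<in>I False. E o'))"
    unfolding indep_set_def by (rule indep_sets_mono_sets) (auto split: bool.splits)
  define G where "G = sigma (space M) (\<Union>o'\<in>I True. E o')"
  have G_Pow: "(\<Union>o'\<in>I True. E o') \<subseteq> Pow (space M)" using E_Pow by blast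
  have space_G: "space G = space M" and sets_G: "sets G = sigma_sets (space M) (\<Union>o'\<in>I True. E o')"
    unfolding G_def using G_Pow by (auto simp: space_measure_of sets_measure_of)
  have E_sub: "E o' \<subseteq> sets G" if "o' \<in> I True" for o'
    using that unfolding sets_G by (auto intro!: sigma_sets.Basic)
  have x0: "x 0 \<in> borel_measurable G"
    using E_sub[of None] by (intro measurable_if_rv_sigma_subset[where M = M] space_G) (auto simp: E_def I_def)
  have sample: "xi a t \<in> borel_measurable G" if "(a, t) \<in> batch_indices N" "t < k \<or> (a, t) = (j, k)" for a t
    using E_sub[of "Some (a, t)"] that
    by (intro measurable_if_rv_sigma_subset[where M = M] space_G) (auto simp: E_def I_def)
  have [measurable]: "x k \<in> borel_measurable G"
    by (rule iterates_measurable(1)[OF space_G x0]) (use sample in auto)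
  have [measurable]: "dev j k \<in> borel_measurable G"
    unfolding dev_def[abs_def] using sample ij by (intro measurable_deviation) auto
  have pair: "(\<lambda>w. (x k w, dev j k w $ c)) \<in> measurable G (borel \<Otimes>\<^sub>M borel)"
    unfolding cart_eq_inner_axis by measurable
  have "{(\<lambda>w. (x k w, dev j k w $ c)) -` P \<inter> space M | P. P \<in> sets (borel \<Otimes>\<^sub>M borel)}
      \<subseteq> sigma_sets (space M) (\<Union>o'\<in>I True. E o')"
    using measurable_sets[OF pair] by (auto simp: space_G sets_G)
  moreover have "{xi i k -` Q \<inter> space M | Q. Q \<in> sets borel} \<subseteq> sigma_sets (space M) (\<Union>o'\<in>I False. E o')"
    by (auto simp: I_def E_def rv_sigma_eq intro!: sigma_sets.Basic)
  ultimately show ?thesis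
    using ind unfolding indep_set_def by (elim indep_sets_mono_sets) (auto split: bool.splits)
qed

text \<open>Unbiasedness of sample \<open>j\<close> is given relative to the past, not to the past
  together with sample \<open>i\<close>. Hence \<open>xi i k\<close> is frozen by independence,
  which turns \<open>dev i k\<close> into a function of \<open>x k\<close>.\<close>

lemma integral_inner_dev_dev_eq_0:
  assumes ij: "(i, k) \<in> batch_indices N" "(j, k) \<in> batch_indices N" "i \<noteq> j"
  shows "expectation (\<lambda>w. dev i k w \<bullet> dev j k w) = 0"
proof -
  have i: "integrable M (\<lambda>w. dev i k w $ c * dev j k w $ c)" for c
    using square_integrable_inner[OF square_integrable_component[OF dev_square_integrable[OF ij(1)]]
        square_integrable_component[OF dev_square_integrable[OF ij(2)]]] by simp
  have "expectation (\<lambda>w. dev i k w $ c * dev j k w $ c) = 0" for c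
  proof -
    define \<phi> where "\<phi> p = (gF (fst p) (snd p) - gf (fst p)) $ c" for p
    have \<phi>: "\<phi> \<in> borel_measurable (borel \<Otimes>\<^sub>M borel)"
      unfolding \<phi>_def cart_eq_inner_axis
      using measurable_deviation[of fst "borel \<Otimes>\<^sub>M borel" snd] by measurable
    have dev_\<phi>: "dev i k w $ c = \<phi> (x k w, xi i k w)" for w by (simp add: dev_def \<phi>_def)
    show ?thesis
      using i[of c] unfolding dev_\<phi>
      by (rule integral_mult_freeze_eq_0[OF subalgebra_past x_past dev_cond_exp[OF ij(2)]
          square_integrable_measurable[OF square_integrable_component[OF dev_square_integrable[OF ij(2)]]]
          sample_rv[OF ij(1)] indep_past_dev_sample[OF ij] \<phi>])
  qed
  then show ?thesis
    using i by (simp add: inner_vec_def)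
qed

text \<open>After expanding the square only the \<open>N k\<close> diagonal terms survive, each at
  most \<open>\<nu>\<^sup>2\<close>, against the factor \<open>1 / (N k)\<^sup>2\<close>.\<close>

lemma noise_second_moment: "expectation (\<lambda>w. (norm (noise k w))\<^sup>2) \<le> \<nu>\<^sup>2 / real (N k)"
proof -
  let ?n = "real (N k)"
  have n: "?n > 0" using batch_pos by simp
  have int: "integrable M (\<lambda>w. dev i k w \<bullet> dev j k w)" if "i \<in> {1..N k}" "j \<in> {1..N k}" for i j
    using that by (intro square_integrable_inner dev_square_integrable batch_indexI)
  have sq: "(norm (noise k w))\<^sup>2 = (1 / ?n)\<^sup>2 * (\<Sum>i=1..N k. \<Sum>j=1..N k. dev i k w \<bullet> dev j k w)" for w
    unfolding noise_eq norm_scaleR power_mult_distrib power2_norm_eq_inner inner_sum_left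
    unfolding inner_sum_right by simp
  have "expectation (\<lambda>w. \<Sum>i=1..N k. \<Sum>j=1..N k. dev i k w \<bullet> dev j k w)
      = (\<Sum>i=1..N k. expectation (\<lambda>w. \<Sum>j=1..N k. dev i k w \<bullet> dev j k w))"
    by (intro Bochner_Integration.integral_sum Bochner_Integration.integrable_sum int)
  also have "\<dots> = (\<Sum>i=1..N k. \<Sum>j=1..N k. expectation (\<lambda>w. dev i k w \<bullet> dev j k w))"
    by (intro sum.cong refl Bochner_Integration.integral_sum int)
  finally have "expectation (\<lambda>w. (norm (noise k w))\<^sup>2)
      = (1 / ?n)\<^sup>2 * (\<Sum>i=1..N k. \<Sum>j=1..N k. expectation (\<lambda>w. dev i k w \<bullet> dev j k w))"
    unfolding sq by simp
  also have "\<dots> = (1 / ?n)\<^sup>2 * (\<Sum>i=1..N k. \<Sum>j=1..N k.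
      if j = i then expectation (\<lambda>w. (norm (dev i k w))\<^sup>2) else 0)"
    by (intro arg_cong2[where f = "(*)"] refl sum.cong)
      (auto simp: power2_norm_eq_inner intro!: integral_inner_dev_dev_eq_0 batch_indexI)
  also have "\<dots> = (1 / ?n)\<^sup>2 * (\<Sum>i=1..N k. expectation (\<lambda>w. (norm (dev i k w))\<^sup>2))"
    by simp
  also have "\<dots> \<le> (1 / ?n)\<^sup>2 * (\<Sum>i=1..N k. \<nu>\<^sup>2)"
    by (intro mult_left_mono sum_mono dev_second_moment batch_indexI) auto
  also have "\<dots> = \<nu>\<^sup>2 / ?n"
    using n by (simp add: power2_eq_square)
  finally show ?thesis .
qed

end

section \<open>Hitting times of geometrically decaying sequences\<close>

text \<open>\<open>A * (q / \<rho>) ^ k\<close> tends to 0 and eventually fits into the gap C - B,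
  so the constant \<open>C\<close> can be chosen without regard to \<open>A\<close>.\<close>

lemma eventually_le_if_dominated_rate:
  fixes q \<rho> :: real
  assumes bound: "\<And>k. e k \<le> A * q ^ k + B * \<rho> ^ k" and "0 \<le> q" "q < \<rho>" "B < C"
  shows "\<forall>\<^sub>F k in sequentially. e k \<le> C * \<rho> ^ k"
proof -
  have "(\<lambda>k. A * (q / \<rho>) ^ k) \<longlonglongrightarrow> A * 0"
    using assms by (intro tendsto_mult tendsto_const LIMSEQ_realpow_zero) auto
  then have "\<forall>\<^sub>F k in sequentially. A * (q / \<rho>) ^ k < C - B"
    by (rule order_tendstoD) (use \<open>B < C\<close> in simp)
  then show ?thesis
  proof eventually_elim
    case (elim k)
    have "\<rho> ^ k > 0" using assms by simp
    then have "A * q ^ k \<le> (C - B) * \<rho> ^ k"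
      using elim by (simp add: power_divide pos_divide_less_eq less_imp_le)
    then show ?case using bound[of k] by (simp add: algebra_simps)
  qed
qed

text \<open>The inequality \<open>1 - \<rho> \<le> - ln \<rho>\<close> turns geometric decay into a
  logarithmic index with factor \<open>1 / (1 - \<rho>)\<close>; the factor 2 absorbs everything
  that does not grow with \<open>1 / \<epsilon>\<close>.\<close>

lemma hitting_time_bound:
  fixes \<rho> :: real
  assumes decay: "\<forall>\<^sub>F k in sequentially. e k \<le> C * \<rho> ^ k" and "0 < \<rho>" "\<rho> < 1" "0 < C"
  shows "\<forall>\<^sub>F \<epsilon> in at_right 0. real (LEAST k. e k \<le> \<epsilon>) \<le> 2 / (1 - \<rho>) * ln (1 / \<epsilon>)"
proof -
  obtain k0 where k0: "\<And>k. k \<ge> k0 \<Longrightarrow> e k \<le> C * \<rho> ^ k"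
    using decay unfolding eventually_sequentially by blast
  have "filterlim (\<lambda>\<epsilon>::real. ln (1 / \<epsilon>)) at_top (at_right 0)" by real_asymp
  \<comment> \<open>For such \<epsilon> a second copy of \<open>ln (1 / \<epsilon>)\<close> pays for
    the offset \<open>k0\<close>, the rounding up and \<open>ln C\<close>.\<close>
  then have "\<forall>\<^sub>F \<epsilon> in at_right 0. (1 - \<rho>) * (real k0 + 1) + \<bar>ln C\<bar> \<le> ln (1 / \<epsilon>)"
    by (simp add: filterlim_at_top)
  with eventually_at_right_less[of 0] show ?thesis
  proof eventually_elim
    case (elim \<epsilon>)
    \<comment> \<open>The summand \<open>k0\<close> puts \<open>m\<close> where the decay bound
      holds. The absolute value keeps the rounded number nonnegative, so \<open>nat\<close> loses
      nothing and rounding costs at most 1.\<close>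
    define m where "m = k0 + nat \<lceil>\<bar>ln (C / \<epsilon>)\<bar> / (1 - \<rho>)\<rceil>"
    have "0 < \<epsilon>" using elim by simp
    have "\<bar>ln (C / \<epsilon>)\<bar> / (1 - \<rho>) \<le> real m" unfolding m_def by linarith
    then have "ln (C / \<epsilon>) \<le> (1 - \<rho>) * real m"
      using \<open>\<rho> < 1\<close> by (simp add: field_simps)
    also have "\<dots> \<le> - ln \<rho> * real m"
      using ln_le_minus_one[of \<rho>] assms by (intro mult_right_mono) auto
    finally have "ln (C * \<rho> ^ m) \<le> ln \<epsilon>"
      using assms \<open>0 < \<epsilon>\<close> by (simp add: ln_mult ln_div ln_realpow mult.commute)
    then have "C * \<rho> ^ m \<le> \<epsilon>" using assms \<open>0 < \<epsilon>\<close> by (subst (asm) ln_le_cancel_iff) auto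
    with k0[of m] have "e m \<le> \<epsilon>" by (simp add: m_def)
    then have "(LEAST k. e k \<le> \<epsilon>) \<le> m" by (rule Least_le)
    then have "real (LEAST k. e k \<le> \<epsilon>) \<le> real k0 + 1 + \<bar>ln (C / \<epsilon>)\<bar> / (1 - \<rho>)"
      unfolding m_def using \<open>\<rho> < 1\<close>
      by (smt (verit) divide_nonneg_pos of_nat_add of_nat_le_iff of_nat_nat ceiling_correct
          zero_le_ceiling of_int_of_nat_eq)
    also have "\<dots> = ((1 - \<rho>) * (real k0 + 1) + \<bar>ln (C / \<epsilon>)\<bar>) / (1 - \<rho>)"
      using \<open>\<rho> < 1\<close> by (simp add: field_simps)
    also have "\<dots> \<le> (2 * ln (1 / \<epsilon>)) / (1 - \<rho>)"
    proof (rule divide_right_mono)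
      have "0 \<le> (1 - \<rho>) * (real k0 + 1)" using \<open>\<rho> < 1\<close> by simp
      moreover have "ln (C / \<epsilon>) = ln C + ln (1 / \<epsilon>)"
        using assms \<open>0 < \<epsilon>\<close> by (simp add: ln_div)
      ultimately show "(1 - \<rho>) * (real k0 + 1) + \<bar>ln (C / \<epsilon>)\<bar> \<le> 2 * ln (1 / \<epsilon>)"
        using elim by linarith
    qed (use \<open>\<rho> < 1\<close> in simp)
    finally show ?case by simp
  qed
qed

text \<open>Each \<open>1 / \<rho> ^ (k + 1)\<close> is at least 1, so rounding up at most doubles
  it; after that the induction step is an identity.\<close>

lemma sum_geometric_batches:
  fixes \<rho> :: real
  assumes "0 < \<rho>" "\<rho> < 1" "\<And>k. N k = nat \<lceil>1 / \<rho> ^ (k + 1)\<rceil>"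
  shows "real (\<Sum>k<K. N k) \<le> 2 / (1 - \<rho>) / \<rho> ^ K"
proof (induction K)
  case (Suc K)
  have "1 \<le> 1 / \<rho> ^ (K + 1)" using assms power_le_one[of \<rho> "K + 1"] by (simp add: field_simps)
  then have "real (N K) \<le> 2 / \<rho> ^ (K + 1)" unfolding assms(3) by linarith
  then have "real (\<Sum>k<Suc K. N k) \<le> 2 / (1 - \<rho>) / \<rho> ^ K + 2 / \<rho> ^ (K + 1)"
    using Suc by simp
  also have "\<dots> = 2 / (1 - \<rho>) / \<rho> ^ Suc K"
    using assms(1,2) by (simp add: field_simps)
  finally show ?case .
qed (use assms in simp)

text \<open>By minimality the error one step before the hitting time still exceeds \<epsilon>, so
  the corresponding power of \<rho> is at least \<open>\<epsilon> / C\<close>. The geometric sum is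
  then of order \<open>1 / \<epsilon>\<close> without a logarithm, and the one-step shift costs a
  factor \<open>1 / \<rho>\<close>.\<close>

lemma batches_until_hitting_bound:
  fixes \<rho> :: real
  assumes decay: "\<forall>\<^sub>F k in sequentially. e k \<le> C * \<rho> ^ k"
    and \<rho>: "0 < \<rho>" "\<rho> < 1" and "0 < C" and N: "\<And>k. N k = nat \<lceil>1 / \<rho> ^ (k + 1)\<rceil>"
  shows "\<forall>\<^sub>F \<epsilon> in at_right 0. real (\<Sum>k < (LEAST k. e k \<le> \<epsilon>). N k) \<le> 2 * C / (\<rho> * (1 - \<rho>)) * (1 / \<epsilon>)"
proof -
  obtain k0 where k0: "\<And>k. k \<ge> k0 \<Longrightarrow> e k \<le> C * \<rho> ^ k"
    using decay unfolding eventually_sequentially by blast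
  define D where "D = 2 * C / (\<rho> * (1 - \<rho>))"
  have "0 < D" using assms by (simp add: D_def)
  then have "filterlim (\<lambda>\<epsilon>::real. D * (1 / \<epsilon>)) at_top (at_right 0)" by real_asymp
  then have "\<forall>\<^sub>F \<epsilon> in at_right 0. real (\<Sum>k<k0. N k) \<le> D * (1 / \<epsilon>)"
    by (simp add: filterlim_at_top)
  with eventually_at_right_less[of 0] show ?thesis
    unfolding D_def[symmetric]
  proof eventually_elim
    case (elim \<epsilon>)
    define K where "K = (LEAST k. e k \<le> \<epsilon>)"
    have "real (\<Sum>k<K. N k) \<le> D * (1 / \<epsilon>)"
    \<comment> \<open>Before \<open>k0\<close> no decay is known, but the cost is at most a fixed
      sum, which \<open>D / \<epsilon>\<close> exceeds for small \<epsilon>.\<close>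
    proof (cases "K \<le> k0")
      case True
      then have "(\<Sum>k<K. N k) \<le> (\<Sum>k<k0. N k)" by (intro sum_mono2) auto
      then show ?thesis using elim by linarith
    next
      case False
      then obtain K' where K': "K = Suc K'" "k0 \<le> K'" by (cases K) auto
      then have "\<not> e K' \<le> \<epsilon>" using not_less_Least[of K' "\<lambda>k. e k \<le> \<epsilon>"] by (simp add: K_def)
      then have "\<epsilon> \<le> C * \<rho> ^ K'" using k0[OF K'(2)] by linarith
      then have "1 / \<rho> ^ K' \<le> C * (1 / \<epsilon>)" using elim \<rho> by (simp add: field_simps)
      then have "2 / (\<rho> * (1 - \<rho>)) * (1 / \<rho> ^ K') \<le> 2 / (\<rho> * (1 - \<rho>)) * (C * (1 / \<epsilon>))"
        using \<rho> by (intro mult_left_mono) auto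
      moreover have "real (\<Sum>k<K. N k) \<le> 2 / (\<rho> * (1 - \<rho>)) * (1 / \<rho> ^ K')"
        using sum_geometric_batches[OF \<rho> N, of K] by (simp add: K'(1) mult_ac)
      ultimately show ?thesis by (simp add: D_def mult_ac)
    qed
    then show ?case by (simp add: K_def)
  qed
qed

section \<open>Convergence rate and complexity\<close>

locale accelerated_sgd_rate = accelerated_sgd M F gF f gf xi0 L \<eta> \<nu> \<alpha> \<beta> N xi x y xstar
  for M :: "'w measure" and F :: "real^'m \<Rightarrow> real^'d \<Rightarrow> real" and gF f gf xi0 L \<eta> \<nu> \<alpha> \<beta> N xi x y xstar +
  fixes \<gamma> \<rho> :: real
  assumes step_size: "0 < \<alpha>" "\<alpha> \<le> 1 / L"
    and \<gamma>_eq: "\<gamma> = sqrt (\<alpha> * \<eta>)"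
    and \<beta>_eq: "\<beta> = (1 - \<gamma>) / (1 + \<gamma>)"
    and rate: "1 - \<gamma> < \<rho>" "\<rho> < 1"
    and batch_size: "\<And>k. N k = nat \<lceil>1 / \<rho> ^ (k + 1)\<rceil>"
begin

text \<open>Both gradient bounds are tested on one unit vector; \<open>undefined\<close> names an
  arbitrary coordinate, as index types are nonempty. This is the source of
  \<open>\<gamma> \<le> 1\<close>.\<close>

lemma \<eta>_le_L: "\<eta> \<le> L"
proof -
  define u :: "real^'m" where "u = axis undefined 1"
  have u: "norm u = 1" by (simp add: u_def)
  have "\<eta> \<le> (gf u - gf 0) \<bullet> u" using strongly_convex[of u 0] u by simp
  also have "\<dots> \<le> norm (gf u - gf 0)" using norm_cauchy_schwarz[of "gf u - gf 0" u] u by simp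
  also have "\<dots> \<le> L" using gf_lipschitz[of u 0] u by simp
  finally show ?thesis .
qed

lemma \<alpha>L_le_1: "\<alpha> * L \<le> 1"
  using step_size constants_pos by (simp add: field_simps)

lemma \<gamma>_sq: "\<gamma>\<^sup>2 = \<alpha> * \<eta>" and \<gamma>_pos: "0 < \<gamma>" and \<gamma>_le_1: "\<gamma> \<le> 1"
proof -
  show "\<gamma>\<^sup>2 = \<alpha> * \<eta>" "0 < \<gamma>" using step_size constants_pos by (auto simp: \<gamma>_eq)
  have "\<alpha> * \<eta> \<le> \<alpha> * L" using \<eta>_le_L step_size by simp
  then show "\<gamma> \<le> 1" using \<alpha>L_le_1 by (simp add: \<gamma>_eq)
qed

lemma \<rho>_pos: "0 < \<rho>" using rate \<gamma>_le_1 by simp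

lemma f_upper: "f u \<le> f v + gf v \<bullet> (u - v) + L / 2 * (norm (u - v))\<^sup>2"
proof (rule quadratic_upper_bound[OF f_gradient])
  fix u v
  have "(gf u - gf v) \<bullet> (u - v) \<le> norm (gf u - gf v) * norm (u - v)" by (rule norm_cauchy_schwarz)
  also have "\<dots> \<le> L * norm (u - v) * norm (u - v)" using gf_lipschitz by (rule mult_right_mono) simp
  finally show "(gf u - gf v) \<bullet> (u - v) \<le> L * (norm (u - v))\<^sup>2" by (simp add: power2_eq_square)
qed

lemma f_lower: "f v + gf v \<bullet> (u - v) + \<eta> / 2 * (norm (u - v))\<^sup>2 \<le> f u"
  by (rule quadratic_lower_bound[OF f_gradient strongly_convex])

text \<open>A gradient step of length \<open>1 / L\<close> from \<open>xstar\<close> would lower f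
  by at least \<open>1 / (2 * L)\<close> times the squared gradient norm.\<close>

lemma gf_xstar: "gf xstar = 0"
proof -
  have "f (xstar - (1 / L) *\<^sub>R gf xstar) \<le> f xstar - 1 / L * (norm (gf xstar))\<^sup>2 + L / 2 * ((1 / L)\<^sup>2 * (norm (gf xstar))\<^sup>2)"
    using f_upper[of "xstar - (1 / L) *\<^sub>R gf xstar" xstar] constants_pos
    by (simp add: power_divide power2_norm_eq_inner)
  also have "L / 2 * ((1 / L)\<^sup>2 * (norm (gf xstar))\<^sup>2) = 1 / (2 * L) * (norm (gf xstar))\<^sup>2"
    using constants_pos by (simp add: power2_eq_square)
  finally have "1 / (2 * L) * (norm (gf xstar))\<^sup>2 \<le> 0"
    using minimizer[of "xstar - (1 / L) *\<^sub>R gf xstar"] by simp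
  then show ?thesis using constants_pos by (simp add: divide_le_0_iff)
qed

section \<open>The auxiliary sequence and the Lyapunov function\<close>

definition v :: "nat \<Rightarrow> 'w \<Rightarrow> real^'m" where
  "v k w = (1 / \<gamma>) *\<^sub>R ((1 + \<gamma>) *\<^sub>R x k w - y k w)"

definition lyapunov :: "nat \<Rightarrow> 'w \<Rightarrow> real" where
  "lyapunov k w = f (y k w) - f xstar + \<eta> / 2 * (norm (v k w - xstar))\<^sup>2"

lemma x_eq_y_v: "(1 + \<gamma>) *\<^sub>R x k w = y k w + \<gamma> *\<^sub>R v k w"
  using \<gamma>_pos by (simp add: v_def)

text \<open>The choice of \<open>\<beta>\<close> gives
  \<open>(1 + \<gamma>) * \<beta> = 1 - \<gamma>\<close>, which turns extrapolation into a convex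
  combination followed by a gradient step of length \<open>\<gamma> / \<eta>\<close>. The
  computation is done after multiplying by \<gamma>.\<close>

lemma v_step:
  assumes w: "w \<in> space M"
  shows "v (Suc k) w = (1 - \<gamma>) *\<^sub>R v k w + \<gamma> *\<^sub>R x k w - (\<gamma> / \<eta>) *\<^sub>R (gf (x k w) + noise k w)"
proof -
  let ?g = "gf (x k w) + noise k w"
  have c: "(1 + \<gamma>) * \<beta> = 1 - \<gamma>" using \<gamma>_pos by (simp add: \<beta>_eq)
  have \<gamma>2: "\<gamma> * (\<gamma> / \<eta>) = \<alpha>"
    using \<gamma>_sq constants_pos by (simp add: power2_eq_square)
  have "\<gamma> *\<^sub>R v (Suc k) w = (1 + \<gamma>) *\<^sub>R x (Suc k) w - y (Suc k) w"
    using x_eq_y_v[of "Suc k" w] by simp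
  also have "\<dots> = \<gamma> *\<^sub>R y (Suc k) w + ((1 + \<gamma>) * \<beta>) *\<^sub>R (y (Suc k) w - y k w)"
    unfolding x_step[OF w] scaleR_add_right scaleR_scaleR by (simp add: algebra_simps)
  also have "\<dots> = y (Suc k) w - (1 - \<gamma>) *\<^sub>R y k w"
    unfolding c by (simp add: algebra_simps)
  also have "\<dots> = x k w - \<alpha> *\<^sub>R ?g - (1 - \<gamma>) *\<^sub>R y k w"
    by (simp add: y_step[OF w])
  also have "\<dots> = (1 - \<gamma>) *\<^sub>R ((1 + \<gamma>) *\<^sub>R x k w - y k w) + \<gamma> *\<^sub>R \<gamma> *\<^sub>R x k w - \<alpha> *\<^sub>R ?g"
    by (simp add: algebra_simps)
  also have "(1 + \<gamma>) *\<^sub>R x k w - y k w = \<gamma> *\<^sub>R v k w"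
    using x_eq_y_v[of k w] by simp
  also have "(1 - \<gamma>) *\<^sub>R \<gamma> *\<^sub>R v k w + \<gamma> *\<^sub>R \<gamma> *\<^sub>R x k w - \<alpha> *\<^sub>R ?g
      = \<gamma> *\<^sub>R ((1 - \<gamma>) *\<^sub>R v k w + \<gamma> *\<^sub>R x k w - (\<gamma> / \<eta>) *\<^sub>R ?g)"
    unfolding \<gamma>2[symmetric] by (simp only: scaleR_add_right scaleR_diff_right scaleR_scaleR mult.commute)
  finally show ?thesis using \<gamma>_pos by simp
qed

lemma v_past: "v k \<in> borel_measurable (past k)"
  unfolding v_def[abs_def] using x_past y_past by measurable

lemma v_square_integrable: "square_integrable M (v k)"
  unfolding v_def[abs_def]
  by (intro square_integrable_scaleR square_integrable_diff x_square_integrable y_square_integrable)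

lemma f_gap_upper: "f u - f xstar \<le> L / 2 * (norm (u - xstar))\<^sup>2"
  using f_upper[of u xstar] by (simp add: gf_xstar)

lemma f_gap_lower: "\<eta> / 2 * (norm (u - xstar))\<^sup>2 \<le> f u - f xstar"
  using f_lower[of xstar u] by (simp add: gf_xstar)

text \<open>The objective gap is nonnegative and dominated by its quadratic upper bound at the
  minimizer.\<close>

lemma f_y_integrable: "integrable M (\<lambda>w. f (y k w))"
proof -
  note [measurable] = measurable_f y_rv
  have "integrable M (\<lambda>w. f (y k w) - f xstar)"
  proof (rule Bochner_Integration.integrable_bound)
    show "integrable M (\<lambda>w. L / 2 * (norm (y k w - xstar))\<^sup>2)"
      using square_integrable_diff[OF y_square_integrable square_integrable_const[of xstar]]
      by (auto simp: square_integrable_def)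
    show "AE w in M. norm (f (y k w) - f xstar) \<le> norm (L / 2 * (norm (y k w - xstar))\<^sup>2)"
      using f_gap_upper minimizer constants_pos by (auto simp: abs_mult)
  qed measurable
  from Bochner_Integration.integrable_add[OF this integrable_const[of "f xstar"]] show ?thesis by simp
qed

lemma integrable_norm_diff_xstar:
  "integrable M (\<lambda>w. (norm (x k w - xstar))\<^sup>2)" "integrable M (\<lambda>w. (norm (v k w - xstar))\<^sup>2)"
  using square_integrable_diff[OF x_square_integrable square_integrable_const[of xstar]]
    square_integrable_diff[OF v_square_integrable square_integrable_const[of xstar]]
  by (auto simp: square_integrable_def)

lemma lyapunov_integrable: "integrable M (lyapunov k)"
  unfolding lyapunov_def[abs_def] using f_y_integrable integrable_norm_diff_xstar(2) by auto

lemma expectation_lyapunov_step: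
  "expectation (lyapunov (Suc k)) \<le> (1 - \<gamma>) * expectation (lyapunov k) + \<alpha> * \<nu>\<^sup>2 * \<rho> ^ Suc k"
proof -
  \<comment> \<open>The vector paired with the error in \<open>accelerated_lyapunov_step\<close>; it
    depends on the past only, so its product with the noise has mean zero.\<close>
  define d where "d w = (1 - \<gamma>) *\<^sub>R v k w + \<gamma> *\<^sub>R x k w - xstar - (\<gamma> / \<eta>) *\<^sub>R gf (x k w)" for w
  note [measurable] = v_past x_past measurable_gf
  have d: "d \<in> borel_measurable (past k)" "square_integrable M d"
    unfolding d_def[abs_def]
    by (measurable, intro square_integrable_diff square_integrable_add square_integrable_scaleR
        v_square_integrable x_square_integrable gf_square_integrable square_integrable_const)
  have id: "integrable M (\<lambda>w. d w \<bullet> noise k w)"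
    by (intro square_integrable_inner d noise_square_integrable)
  have in2: "integrable M (\<lambda>w. (norm (noise k w))\<^sup>2)"
    using noise_square_integrable by (simp add: square_integrable_def)
  have "expectation (lyapunov (Suc k))
      \<le> expectation (\<lambda>w. (1 - \<gamma>) * lyapunov k w + \<alpha> * (norm (noise k w))\<^sup>2 - \<gamma> * (d w \<bullet> noise k w))"
  proof (rule integral_mono)
    fix w assume w: "w \<in> space M"
    show "lyapunov (Suc k) w \<le> (1 - \<gamma>) * lyapunov k w + \<alpha> * (norm (noise k w))\<^sup>2 - \<gamma> * (d w \<bullet> noise k w)"
      unfolding lyapunov_def d_def
      by (rule accelerated_lyapunov_step[OF f_lower f_upper constants_pos(2) step_size(1) \<alpha>L_le_1
          \<gamma>_sq less_imp_le[OF \<gamma>_pos] \<gamma>_le_1 x_eq_y_v y_step[OF w] v_step[OF w]])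
  qed (use lyapunov_integrable id in2 in auto)
  also have "\<dots> = (1 - \<gamma>) * expectation (lyapunov k) + \<alpha> * expectation (\<lambda>w. (norm (noise k w))\<^sup>2)"
    using lyapunov_integrable[of k] id in2 integral_inner_noise_eq_0[OF d] by simp
  also have "expectation (\<lambda>w. (norm (noise k w))\<^sup>2) \<le> \<nu>\<^sup>2 * \<rho> ^ Suc k"
  proof -
    \<comment> \<open>Rounding the batch size up acts in the favourable direction.\<close>
    have "1 / \<rho> ^ Suc k \<le> real (N k)" unfolding batch_size by simp linarith
    then have "\<nu>\<^sup>2 / real (N k) \<le> \<nu>\<^sup>2 / (1 / \<rho> ^ Suc k)"
      using \<rho>_pos by (intro divide_left_mono) (auto intro!: mult_pos_pos simp: batch_pos)
    with noise_second_moment[of k] show ?thesis by simp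
  qed
  finally show ?thesis using step_size by (simp add: mult_ac)
qed

text \<open>The number B for which \<open>B * \<rho> ^ k\<close> reproduces itself under the
  recursion of \<open>expectation_lyapunov_step\<close>.\<close>

definition noise_level :: real where
  "noise_level = \<alpha> * \<nu>\<^sup>2 * \<rho> / (\<rho> - (1 - \<gamma>))"

lemma noise_level_nonneg: "0 \<le> noise_level"
  using step_size rate \<rho>_pos by (simp add: noise_level_def)

lemma expectation_lyapunov_nonneg: "0 \<le> expectation (lyapunov k)"
  using minimizer constants_pos by (intro integral_nonneg_AE) (simp add: lyapunov_def)

lemma expectation_lyapunov_le:
  "expectation (lyapunov k) \<le> expectation (lyapunov 0) * (1 - \<gamma>) ^ k + noise_level * \<rho> ^ k"
proof (induction k)
  case (Suc k)
  have B: "(\<rho> - (1 - \<gamma>)) * noise_level = \<alpha> * \<nu>\<^sup>2 * \<rho>" using rate by (simp add: noise_level_def)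
  have "expectation (lyapunov (Suc k)) \<le> (1 - \<gamma>) * expectation (lyapunov k) + \<alpha> * \<nu>\<^sup>2 * \<rho> ^ Suc k"
    by (rule expectation_lyapunov_step)
  also have "\<dots> \<le> (1 - \<gamma>) * (expectation (lyapunov 0) * (1 - \<gamma>) ^ k + noise_level * \<rho> ^ k)
      + \<alpha> * \<nu>\<^sup>2 * \<rho> * \<rho> ^ k"
    using mult_left_mono[OF Suc, of "1 - \<gamma>"] \<gamma>_le_1 by (simp add: mult_ac)
  also have "\<dots> = expectation (lyapunov 0) * (1 - \<gamma>) ^ Suc k + noise_level * \<rho> ^ Suc k"
    unfolding B[symmetric] by (simp add: algebra_simps)
  finally show ?case .
qed (use noise_level_nonneg in simp)

lemma expectation_lyapunov_le_rate:
  "expectation (lyapunov k) \<le> \<rho> ^ k * (expectation (lyapunov 0) + noise_level)"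
proof -
  have "(1 - \<gamma>) ^ k \<le> \<rho> ^ k" using \<gamma>_le_1 rate by (intro power_mono) auto
  then have "expectation (lyapunov 0) * (1 - \<gamma>) ^ k \<le> expectation (lyapunov 0) * \<rho> ^ k"
    using expectation_lyapunov_nonneg by (rule mult_left_mono)
  with expectation_lyapunov_le[of k] show ?thesis by (simp add: algebra_simps)
qed

text \<open>All three sequences start at \<open>x 0\<close>: the objective gap contributes
  \<open>L / 2\<close> and the distance term \<open>\<eta> / 2\<close>.\<close>

lemma expectation_lyapunov_0:
  "expectation (lyapunov 0) \<le> (\<eta> + L) / 2 * expectation (\<lambda>w. (norm (x 0 w - xstar))\<^sup>2)"
proof -
  have "expectation (lyapunov 0) \<le> expectation (\<lambda>w. (\<eta> + L) / 2 * (norm (x 0 w - xstar))\<^sup>2)"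
  proof (rule integral_mono)
    fix w assume "w \<in> space M"
    then have "y 0 w = x 0 w" using start by simp
    moreover from this have "v 0 w = x 0 w" using \<gamma>_pos by (simp add: v_def algebra_simps)
    ultimately show "lyapunov 0 w \<le> (\<eta> + L) / 2 * (norm (x 0 w - xstar))\<^sup>2"
      using f_gap_upper[of "x 0 w"] by (simp add: lyapunov_def algebra_simps add_divide_distrib)
  qed (use lyapunov_integrable integrable_norm_diff_xstar in auto)
  then show ?thesis by simp
qed

lemma objective_gap_le:
  "expectation (\<lambda>w. f (y k w)) - f xstar
    \<le> \<rho> ^ k * ((\<eta> + L) / 2 * expectation (\<lambda>w. (norm (x 0 w - xstar))\<^sup>2)
        + \<rho> * \<nu>\<^sup>2 / (\<rho> - (1 - \<gamma>)) * (\<alpha> + (1 - \<gamma>) * \<gamma> / (2 * \<eta>)))"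
proof -
  have "expectation (\<lambda>w. f (y k w) - f xstar) \<le> expectation (lyapunov k)"
    using f_y_integrable lyapunov_integrable constants_pos
    by (intro integral_mono) (auto simp: lyapunov_def)
  then have "expectation (\<lambda>w. f (y k w)) - f xstar \<le> expectation (lyapunov k)"
    using f_y_integrable by (simp add: prob_space)
  also have "\<dots> \<le> \<rho> ^ k * (expectation (lyapunov 0) + noise_level)"
    by (rule expectation_lyapunov_le_rate)
  also have "\<dots> \<le> \<rho> ^ k * ((\<eta> + L) / 2 * expectation (\<lambda>w. (norm (x 0 w - xstar))\<^sup>2)
        + \<rho> * \<nu>\<^sup>2 / (\<rho> - (1 - \<gamma>)) * (\<alpha> + (1 - \<gamma>) * \<gamma> / (2 * \<eta>)))"
  proof (intro mult_left_mono add_mono expectation_lyapunov_0)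
    \<comment> \<open>The noise level matches the summand \<alpha>; the other summand is nonnegative
      because \<open>\<gamma> \<le> 1\<close>.\<close>
    have "noise_level = \<rho> * \<nu>\<^sup>2 / (\<rho> - (1 - \<gamma>)) * \<alpha>" by (simp add: noise_level_def)
    also have "\<dots> \<le> \<rho> * \<nu>\<^sup>2 / (\<rho> - (1 - \<gamma>)) * (\<alpha> + (1 - \<gamma>) * \<gamma> / (2 * \<eta>))"
      using \<rho>_pos rate \<gamma>_pos \<gamma>_le_1 constants_pos by (intro mult_left_mono) auto
    finally show "noise_level \<le> \<rho> * \<nu>\<^sup>2 / (\<rho> - (1 - \<gamma>)) * (\<alpha> + (1 - \<gamma>) * \<gamma> / (2 * \<eta>))" .
  qed (use \<rho>_pos in simp)
  finally show ?thesis .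
qed

text \<open>The extrapolated point \<open>x k\<close> is a convex combination of \<open>y k\<close> and \<open>v k\<close>.\<close>

lemma norm_diff_xstar_le_lyapunov: "(norm (x k w - xstar))\<^sup>2 \<le> 2 / \<eta> * lyapunov k w"
proof -
  define t where "t = \<gamma> / (1 + \<gamma>)"
  have t: "0 \<le> t" "t \<le> 1" "1 - t = 1 / (1 + \<gamma>)" using \<gamma>_pos by (auto simp: t_def field_simps)
  have "x k w = (1 / (1 + \<gamma>)) *\<^sub>R ((1 + \<gamma>) *\<^sub>R x k w)" using \<gamma>_pos by simp
  also have "\<dots> = (1 - t) *\<^sub>R y k w + t *\<^sub>R v k w"
    unfolding x_eq_y_v t(3) by (simp add: t_def scaleR_add_right)
  finally have "x k w - xstar = (1 - t) *\<^sub>R (y k w - xstar) + t *\<^sub>R (v k w - xstar)"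
    by (simp add: algebra_simps)
  then have "(norm (x k w - xstar))\<^sup>2 \<le> (1 - t) * (norm (y k w - xstar))\<^sup>2 + t * (norm (v k w - xstar))\<^sup>2"
    using norm_convex_combination_square[OF t(1,2)] by simp
  also have "\<dots> \<le> 1 * (norm (y k w - xstar))\<^sup>2 + 1 * (norm (v k w - xstar))\<^sup>2"
    using t by (intro add_mono mult_right_mono) auto
  \<comment> \<open>Strong convexity bounds the distance of \<open>y k\<close> by the objective gap;
    the distance of \<open>v k\<close> is already part of the potential.\<close>
  also have "\<dots> \<le> 2 / \<eta> * lyapunov k w"
    using f_gap_lower[of "y k w"] constants_pos by (simp add: lyapunov_def field_simps)
  finally show ?thesis .
qed

lemma mean_sq_error_le_lyapunov: "mean_sq_error M x xstar k \<le> 2 / \<eta> * expectation (lyapunov k)"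
proof -
  have "mean_sq_error M x xstar k \<le> expectation (\<lambda>w. 2 / \<eta> * lyapunov k w)"
    unfolding mean_sq_error_def
    by (intro integral_mono integrable_mult_right lyapunov_integrable integrable_norm_diff_xstar
        norm_diff_xstar_le_lyapunov)
  then show ?thesis by simp
qed

lemma mean_sq_error_decay: "\<exists>c>0. \<forall>k. mean_sq_error M x xstar k \<le> c * \<rho> ^ k"
proof (intro exI conjI allI)
  \<comment> \<open>The summand 1 gives strict positivity from nonnegativity of the rest.\<close>
  define c where "c = 2 / \<eta> * (expectation (lyapunov 0) + noise_level) + 1"
  show "0 < c"
    unfolding c_def using expectation_lyapunov_nonneg[of 0] noise_level_nonneg constants_pos
    by (intro add_nonneg_pos mult_nonneg_nonneg) auto
  fix k
  have "mean_sq_error M x xstar k \<le> 2 / \<eta> * (\<rho> ^ k * (expectation (lyapunov 0) + noise_level))"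
    using mean_sq_error_le_lyapunov[of k] mult_left_mono[OF expectation_lyapunov_le_rate[of k], of "2 / \<eta>"]
      constants_pos by simp
  also have "\<dots> \<le> c * \<rho> ^ k" using \<rho>_pos by (simp add: c_def algebra_simps)
  finally show "mean_sq_error M x xstar k \<le> c * \<rho> ^ k" .
qed

section \<open>Complexity bounds with constants independent of the condition number\<close>

abbreviation rel_rate :: real where
  "rel_rate \<equiv> (1 - \<rho>) / \<gamma>"

text \<open>Measured in units of \<gamma>, the margin \<open>1 - \<rho>\<close> ranges over (0,1)
  whatever the conditioning. The last bound later replaces \<open>1 / \<rho>\<close> by a quantity
  free of the condition number.\<close>

lemma rel_rate: "0 < rel_rate" "rel_rate < 1" "\<rho> = 1 - rel_rate * \<gamma>" "1 - rel_rate \<le> \<rho>"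
proof -
  show "0 < rel_rate" "rel_rate < 1" "\<rho> = 1 - rel_rate * \<gamma>" using rate \<gamma>_pos by (auto simp: field_simps)
  have "rel_rate * \<gamma> \<le> rel_rate" using \<gamma>_le_1 \<open>0 < rel_rate\<close> by (intro mult_left_le) auto
  then show "1 - rel_rate \<le> \<rho>" using \<open>\<rho> = _\<close> by simp
qed

text \<open>The denominator equals \<open>\<gamma> * (1 - rel_rate)\<close>, and
  \<open>\<alpha> / \<gamma> = \<gamma> / \<eta>\<close>; bounding \<open>\<gamma> * \<rho>\<close>
  by 1 then removes the dependence on \<open>L\<close>.\<close>

lemma noise_level_le: "noise_level \<le> \<nu>\<^sup>2 / (\<eta> * (1 - rel_rate))"
proof -
  define r where "r = rel_rate"
  have r: "0 < 1 - r" "\<rho> - (1 - \<gamma>) = \<gamma> * (1 - r)"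
    using rel_rate(2,3) by (simp_all add: r_def[symmetric] algebra_simps)
  have "noise_level = (\<alpha> / \<gamma>) * (\<rho> * \<nu>\<^sup>2 / (1 - r))"
    by (simp add: noise_level_def r(2))
  also have "\<alpha> / \<gamma> = \<gamma> / \<eta>"
    using \<gamma>_sq \<gamma>_pos constants_pos by (simp add: field_simps power2_eq_square)
  also have "\<gamma> / \<eta> * (\<rho> * \<nu>\<^sup>2 / (1 - r)) = (\<gamma> * \<rho>) * (\<nu>\<^sup>2 / (\<eta> * (1 - r)))"
    by simp
  also have "\<dots> \<le> 1 * (\<nu>\<^sup>2 / (\<eta> * (1 - r)))"
    using \<gamma>_le_1 rate \<rho>_pos constants_pos r(1) \<gamma>_pos by (intro mult_right_mono mult_le_one) auto
  finally show ?thesis by (simp add: r_def)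
qed

text \<open>The contribution of the initial point decays at the faster rate \<open>1 - \<gamma>\<close>, so the
  asymptotic constant is governed by the noise alone.\<close>

lemma mean_sq_error_asymptotic:
  "\<forall>\<^sub>F k in sequentially. mean_sq_error M x xstar k
    \<le> 2 / \<eta> * (1 + \<nu>\<^sup>2 / (\<eta> * (1 - rel_rate))) * \<rho> ^ k"
proof (rule eventually_le_if_dominated_rate)
  fix k
  show "mean_sq_error M x xstar k \<le> 2 / \<eta> * expectation (lyapunov 0) * (1 - \<gamma>) ^ k + 2 / \<eta> * noise_level * \<rho> ^ k"
    using mean_sq_error_le_lyapunov[of k] mult_left_mono[OF expectation_lyapunov_le[of k], of "2 / \<eta>"]
      constants_pos by (simp add: algebra_simps)
  \<comment> \<open>The summand 1 provides the strict gap into which the initial error has to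
    fit.\<close>
  show "2 / \<eta> * noise_level < 2 / \<eta> * (1 + \<nu>\<^sup>2 / (\<eta> * (1 - rel_rate)))"
    using noise_level_le constants_pos by (intro mult_strict_left_mono) auto
qed (use \<gamma>_le_1 rate in auto)

text \<open>Here the square root of the condition number arises: \<open>1 - \<rho>\<close> is
  \<open>rel_rate * \<gamma>\<close>, and \<gamma> is \<open>sqrt (\<alpha> * L)\<close> divided by
  \<open>sqrt (L / \<eta>)\<close>.\<close>

lemma inverse_one_minus_\<rho>: "1 / (1 - \<rho>) = 1 / (rel_rate * sqrt (\<alpha> * L)) * sqrt (L / \<eta>)"
proof -
  have "sqrt (\<alpha> * L) = \<gamma> * sqrt (L / \<eta>)"
    using constants_pos by (simp add: \<gamma>_eq flip: real_sqrt_mult)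
  moreover have "sqrt (L / \<eta>) \<noteq> 0" using constants_pos by simp
  ultimately show ?thesis using \<gamma>_pos by simp
qed

lemma iteration_complexity_bound:
  "\<forall>\<^sub>F \<epsilon> in at_right 0. real (iteration_complexity M x xstar \<epsilon>)
    \<le> 2 / (rel_rate * sqrt (\<alpha> * L)) * sqrt (L / \<eta>) * ln (1 / \<epsilon>)"
proof -
  have "0 < 2 / \<eta> * (1 + \<nu>\<^sup>2 / (\<eta> * (1 - rel_rate)))"
    using constants_pos rel_rate by (intro mult_pos_pos add_pos_pos divide_pos_pos) auto
  moreover have "2 / (1 - \<rho>) = 2 / (rel_rate * sqrt (\<alpha> * L)) * sqrt (L / \<eta>)"
    using arg_cong[OF inverse_one_minus_\<rho>, of "\<lambda>z. 2 * z"] by simp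
  ultimately show ?thesis
    using hitting_time_bound[OF mean_sq_error_asymptotic \<rho>_pos rate(2)]
    by (simp add: iteration_complexity_def)
qed

lemma oracle_complexity_bound:
  "\<forall>\<^sub>F \<epsilon> in at_right 0. real (oracle_complexity M N x xstar \<epsilon>)
    \<le> 4 / \<eta> * (1 + \<nu>\<^sup>2 / (\<eta> * (1 - rel_rate))) / ((1 - rel_rate) * (rel_rate * sqrt (\<alpha> * L)))
      * sqrt (L / \<eta>) * (1 / \<epsilon>)"
proof -
  define C where "C = 2 / \<eta> * (1 + \<nu>\<^sup>2 / (\<eta> * (1 - rel_rate)))"
  have C: "0 < C"
    unfolding C_def using constants_pos rel_rate by (intro mult_pos_pos add_pos_pos divide_pos_pos) auto
  have "2 * C / (\<rho> * (1 - \<rho>)) = 2 * C / \<rho> * (1 / (1 - \<rho>))" by simp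
  \<comment> \<open>Once \<open>1 / \<rho>\<close> is bounded by \<open>1 / (1 - rel_rate)\<close>,
    the condition number enters only through \<open>1 / (1 - \<rho>)\<close>.\<close>
  also have "\<dots> \<le> 2 * C / (1 - rel_rate) * (1 / (1 - \<rho>))"
    using C rel_rate \<rho>_pos rate by (intro mult_right_mono divide_left_mono) auto
  also have "\<dots> = 2 * C / ((1 - rel_rate) * (rel_rate * sqrt (\<alpha> * L))) * sqrt (L / \<eta>)"
    unfolding inverse_one_minus_\<rho> by simp
  finally have le: "2 * C / (\<rho> * (1 - \<rho>)) \<le> 2 * C / ((1 - rel_rate) * (rel_rate * sqrt (\<alpha> * L))) * sqrt (L / \<eta>)" .
  have "\<forall>\<^sub>F \<epsilon> in at_right 0. real (oracle_complexity M N x xstar \<epsilon>) \<le> 2 * C / (\<rho> * (1 - \<rho>)) * (1 / \<epsilon>)"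
    unfolding oracle_complexity_def iteration_complexity_def
    by (rule batches_until_hitting_bound[OF mean_sq_error_asymptotic[folded C_def] \<rho>_pos rate(2) C batch_size])
  with eventually_at_right_less[of "0::real"] show ?thesis
  proof eventually_elim
    case (elim \<epsilon>)
    note elim(2)
    also have "2 * C / (\<rho> * (1 - \<rho>)) * (1 / \<epsilon>)
        \<le> 2 * C / ((1 - rel_rate) * (rel_rate * sqrt (\<alpha> * L))) * sqrt (L / \<eta>) * (1 / \<epsilon>)"
      using le elim(1) by (intro mult_right_mono) auto
    finally show ?case by (simp add: C_def)
  qed
qed

end

(* Big-O as \<epsilon> \<rightarrow> 0: the constants Ci, Co are chosen before the problem instance and do not
   depend on the condition number \<kappa> = L / \<eta>; they depend only on the relative step size
   \<alpha> L in (0,1], the relative rate (1 - \<rho>) / \<gamma> in (0,1) and, for Co, on \<eta> and \<nu>. *)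
theorem proposition2:
  shows "\<exists>(Ci :: real \<Rightarrow> real \<Rightarrow> real) (Co :: real \<Rightarrow> real \<Rightarrow> real \<Rightarrow> real \<Rightarrow> real).
    \<forall>(M :: 'w measure) (F :: real^'m \<Rightarrow> real^'d \<Rightarrow> real) gF f gf xi0 L \<eta> \<nu> \<alpha> \<beta> \<gamma> \<rho> N xi x y xstar.
      accelerated_sgd M F gF f gf xi0 L \<eta> \<nu> \<alpha> \<beta> N xi x y xstar \<and>
      0 < \<alpha> \<and> \<alpha> \<le> 1 / L \<and>
      \<gamma> = sqrt (\<alpha> * \<eta>) \<and>
      \<beta> = (1 - \<gamma>) / (1 + \<gamma>) \<and>
      1 - \<gamma> < \<rho> \<and> \<rho> < 1 \<and>
      (\<forall>k. N k = nat \<lceil>1 / \<rho> ^ (k + 1)\<rceil>)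
      \<longrightarrow>
      (\<forall>k. integrable M (\<lambda>w. f (y k w)) \<and>
        (\<integral>w. f (y k w) \<partial>M) - f xstar
          \<le> \<rho> ^ k * ((\<eta> + L) / 2 * (\<integral>w. (norm (x 0 w - xstar))\<^sup>2 \<partial>M)
              + \<rho> * \<nu>\<^sup>2 / (\<rho> - (1 - \<gamma>)) * (\<alpha> + (1 - \<gamma>) * \<gamma> / (2 * \<eta>)))) \<and>
      (\<exists>c>0. \<forall>k. integrable M (\<lambda>w. (norm (x k w - xstar))\<^sup>2) \<and>
        (\<integral>w. (norm (x k w - xstar))\<^sup>2 \<partial>M) \<le> c * \<rho> ^ k) \<and>
      (\<forall>\<^sub>F \<epsilon> in at_right 0.
        real (iteration_complexity M x xstar \<epsilon>)
          \<le> Ci (\<alpha> * L) ((1 - \<rho>) / \<gamma>) * sqrt (L / \<eta>) * ln (1 / \<epsilon>)) \<and>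
      (\<forall>\<^sub>F \<epsilon> in at_right 0.
        real (oracle_complexity M N x xstar \<epsilon>)
          \<le> Co (\<alpha> * L) ((1 - \<rho>) / \<gamma>) \<eta> \<nu> * sqrt (L / \<eta>) * (1 / \<epsilon>))"
\<comment> \<open>The witnesses are the factors of \<open>iteration_complexity_bound\<close> and
  \<open>oracle_complexity_bound\<close>, with \<open>a\<close> for \<open>\<alpha> * L\<close> and
  \<open>r\<close> for the relative rate.\<close>
proof (intro exI[where x = "\<lambda>a r. 2 / (r * sqrt a)"]
    exI[where x = "\<lambda>a r \<eta> \<nu>. 4 / \<eta> * (1 + \<nu>\<^sup>2 / (\<eta> * (1 - r))) / ((1 - r) * (r * sqrt a))"]
    allI impI)
  fix M :: "'w measure" and F :: "real^'m \<Rightarrow> real^'d \<Rightarrow> real"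
  fix gF f gf xi0 L \<eta> \<nu> \<alpha> \<beta> \<gamma> \<rho> N xi x y xstar
  assume A: "accelerated_sgd M F gF f gf xi0 L \<eta> \<nu> \<alpha> \<beta> N xi x y xstar \<and>
      0 < \<alpha> \<and> \<alpha> \<le> 1 / L \<and>
      \<gamma> = sqrt (\<alpha> * \<eta>) \<and>
      \<beta> = (1 - \<gamma>) / (1 + \<gamma>) \<and>
      1 - \<gamma> < \<rho> \<and> \<rho> < 1 \<and>
      (\<forall>k. N k = nat \<lceil>1 / \<rho> ^ (k + 1)\<rceil>)"
  then interpret accelerated_sgd_rate M F gF f gf xi0 L \<eta> \<nu> \<alpha> \<beta> N xi x y xstar \<gamma> \<rho>
    unfolding accelerated_sgd_rate_def accelerated_sgd_rate_axioms_def by blast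
  show "(\<forall>k. integrable M (\<lambda>w. f (y k w)) \<and>
        (\<integral>w. f (y k w) \<partial>M) - f xstar
          \<le> \<rho> ^ k * ((\<eta> + L) / 2 * (\<integral>w. (norm (x 0 w - xstar))\<^sup>2 \<partial>M)
              + \<rho> * \<nu>\<^sup>2 / (\<rho> - (1 - \<gamma>)) * (\<alpha> + (1 - \<gamma>) * \<gamma> / (2 * \<eta>)))) \<and>
      (\<exists>c>0. \<forall>k. integrable M (\<lambda>w. (norm (x k w - xstar))\<^sup>2) \<and>
        (\<integral>w. (norm (x k w - xstar))\<^sup>2 \<partial>M) \<le> c * \<rho> ^ k) \<and>
      (\<forall>\<^sub>F \<epsilon> in at_right 0.
        real (iteration_complexity M x xstar \<epsilon>)
          \<le> 2 / ((1 - \<rho>) / \<gamma> * sqrt (\<alpha> * L)) * sqrt (L / \<eta>) * ln (1 / \<epsilon>)) \<and>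
      (\<forall>\<^sub>F \<epsilon> in at_right 0.
        real (oracle_complexity M N x xstar \<epsilon>)
          \<le> 4 / \<eta> * (1 + \<nu>\<^sup>2 / (\<eta> * (1 - (1 - \<rho>) / \<gamma>)))
              / ((1 - (1 - \<rho>) / \<gamma>) * ((1 - \<rho>) / \<gamma> * sqrt (\<alpha> * L))) * sqrt (L / \<eta>) * (1 / \<epsilon>))"
    using f_y_integrable objective_gap_le mean_sq_error_decay[unfolded mean_sq_error_def]
      integrable_norm_diff_xstar(1) iteration_complexity_bound oracle_complexity_bound
    by blast
qed

end
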